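(* The number $\mathbf{S}(n)$ of subdirectly irreducible idempotent ordered monoids with $n\in\mathbb{N}\setminus\{0\}$ elements (up to isomorphism) is recursively defined by $\mathbf{S}(1)=1$, $\mathbf{S}(2)=2$, $\mathbf{S}(3)=4$, and $$\mathbf{S}(n)=\mathbf{S}(n-1)+2\mathbf{S}(n-2)+2\mathbf{S}(n-3)\qquad(n>3).$$
   Context: An ordered monoid is an algebra $\langle M,\wedge,\vee,\cdot,e\rangle$, where $\langle M,\cdot,e\rangle$ is a monoid and $\wedge,\vee$ are the minimum and maximum operations of a total order $\le$ on $M$ such that $a\le b$ implies $cad\le cbd$ for all $a,b,c,d\in M$. It is idempotent if $a\cdot a=a$ for all $a$. Subdirect irreducibility and isomorphism are meant for algebras in the signature $\{\wedge,\vee,\cdot,e\}$; the one-element algebra is counted as subdirectly irreducible (convention of Burris and Sankappanavar: an algebra is subdirectly irreducible iff it is trivial or has a least non-trivial congruence). *)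

theory Defs
  imports "HOL-Algebra.Group"
begin

text \<open>Algebras in the signature of ordered monoids, as records over an explicit carrier set. Only
  the values of the operations on the carrier matter. The names \<open>wedge\<close> and \<open>vee\<close> avoid a clash with
  \<open>meet\<close> and \<open>join\<close> of HOL-Algebra, which are derived from an order.\<close>

record 'a ordered_monoid = "'a monoid" +
  wedge :: "['a, 'a] \<Rightarrow> 'a" (infixl \<open>\<^bold>\<and>\<index>\<close> 70)
  vee :: "['a, 'a] \<Rightarrow> 'a" (infixl \<open>\<^bold>\<or>\<index>\<close> 65)

locale ordered_monoid = monoid M for M (structure) +
  assumes ex_order: "\<exists>r. linear_order_on (carrier M) r \<and>
    (\<forall>a\<in>carrier M. \<forall>b\<in>carrier M.
       a \<^bold>\<and> b = (if (a, b) \<in> r then a else b) \<and>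
       a \<^bold>\<or> b = (if (a, b) \<in> r then b else a)) \<and>
    (\<forall>a\<in>carrier M. \<forall>b\<in>carrier M. \<forall>c\<in>carrier M. \<forall>d\<in>carrier M.
       (a, b) \<in> r \<longrightarrow> (c \<otimes> a \<otimes> d, c \<otimes> b \<otimes> d) \<in> r)"

locale idempotent_ordered_monoid = ordered_monoid +
  assumes idem: "a \<in> carrier M \<Longrightarrow> a \<otimes> a = a"

definition om_congruence :: "('a, 'm) ordered_monoid_scheme \<Rightarrow> ('a \<times> 'a) set \<Rightarrow> bool" where
  "om_congruence M \<theta> \<longleftrightarrow> equiv (carrier M) \<theta> \<and>
    (\<forall>a a' b b'. (a, a') \<in> \<theta> \<longrightarrow> (b, b') \<in> \<theta> \<longrightarrow>
       (a \<^bold>\<and>\<^bsub>M\<^esub> b, a' \<^bold>\<and>\<^bsub>M\<^esub> b') \<in> \<theta> \<and>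
       (a \<^bold>\<or>\<^bsub>M\<^esub> b, a' \<^bold>\<or>\<^bsub>M\<^esub> b') \<in> \<theta> \<and>
       (a \<otimes>\<^bsub>M\<^esub> b, a' \<otimes>\<^bsub>M\<^esub> b') \<in> \<theta>)"

text \<open>Non-trivial congruences are those different from the identity relation on the carrier; the
  total relation is included among them. One-element algebras count as subdirectly irreducible.\<close>

definition subdirectly_irreducible :: "('a, 'm) ordered_monoid_scheme \<Rightarrow> bool" where
  "subdirectly_irreducible M \<longleftrightarrow> card (carrier M) = 1 \<or>
    (\<exists>\<mu>. om_congruence M \<mu> \<and> \<mu> \<noteq> Id_on (carrier M) \<and>
       (\<forall>\<theta>. om_congruence M \<theta> \<and> \<theta> \<noteq> Id_on (carrier M) \<longrightarrow> \<mu> \<subseteq> \<theta>))"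

definition om_iso ::
  "('a, 'm) ordered_monoid_scheme \<Rightarrow> ('b, 'n) ordered_monoid_scheme \<Rightarrow> ('a \<Rightarrow> 'b) set" where
  "om_iso M N = {h \<in> iso M N. h \<one>\<^bsub>M\<^esub> = \<one>\<^bsub>N\<^esub> \<and>
    (\<forall>a\<in>carrier M. \<forall>b\<in>carrier M.
       h (a \<^bold>\<and>\<^bsub>M\<^esub> b) = h a \<^bold>\<and>\<^bsub>N\<^esub> h b \<and> h (a \<^bold>\<or>\<^bsub>M\<^esub> b) = h a \<^bold>\<or>\<^bsub>N\<^esub> h b)}"

definition om_isomorphic ::
  "('a, 'm) ordered_monoid_scheme \<Rightarrow> ('b, 'n) ordered_monoid_scheme \<Rightarrow> bool" where
  "om_isomorphic M N \<longleftrightarrow> om_iso M N \<noteq> {}"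

text \<open>Isomorphism classes of \<open>n\<close>-element algebras are formed over carriers that are sets of natural
  numbers; \<open>ex_om_isomorphic_nat\<close> below shows that this loses no finite algebra.\<close>

definition si_idempotent_oms :: "nat \<Rightarrow> nat ordered_monoid set" where
  "si_idempotent_oms n = {M. idempotent_ordered_monoid M \<and> subdirectly_irreducible M \<and>
     finite (carrier M) \<and> card (carrier M) = n}"

definition num_si_idempotent_oms :: "nat \<Rightarrow> nat" (\<open>\<^bold>S\<close>) where
  "\<^bold>S n = card (si_idempotent_oms n //
     {(M, N). M \<in> si_idempotent_oms n \<and> N \<in> si_idempotent_oms n \<and> om_isomorphic M N})"

lemma om_isomorphic_refl: "om_isomorphic M M"
proof -
  have "id \<in> om_iso M M"
    by (auto simp: om_iso_def iso_def hom_def)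
  then show ?thesis
    by (auto simp: om_isomorphic_def)
qed

lemma om_isomorphic_trans:
  assumes "om_isomorphic L M" and "om_isomorphic M N"
  shows "om_isomorphic L N"
proof -
  obtain f g where f: "f \<in> om_iso L M" and g: "g \<in> om_iso M N"
    using assms by (auto simp: om_isomorphic_def)
  then have "g \<circ> f \<in> iso L N"
    by (auto simp: om_iso_def iso_def hom_def Pi_iff intro: bij_betw_trans)
  moreover have "f x \<in> carrier M" if "x \<in> carrier L" for x
    using f that by (auto simp: om_iso_def iso_def hom_def)
  ultimately have "g \<circ> f \<in> om_iso L N"
    using f g by (auto simp: om_iso_def)
  then show ?thesis
    by (auto simp: om_isomorphic_def)
qed

lemma ordered_monoid_closed:
  assumes "ordered_monoid M" and "a \<in> carrier M" and "b \<in> carrier M"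
  shows "a \<^bold>\<and>\<^bsub>M\<^esub> b \<in> carrier M" and "a \<^bold>\<or>\<^bsub>M\<^esub> b \<in> carrier M" and "a \<otimes>\<^bsub>M\<^esub> b \<in> carrier M"
proof -
  interpret ordered_monoid M by fact
  show "a \<^bold>\<and>\<^bsub>M\<^esub> b \<in> carrier M" "a \<^bold>\<or>\<^bsub>M\<^esub> b \<in> carrier M" "a \<otimes>\<^bsub>M\<^esub> b \<in> carrier M"
    using ex_order assms(2,3) by auto
qed

lemma om_iso_inv_into:
  assumes M: "ordered_monoid M" and h: "h \<in> om_iso M N"
  shows "inv_into (carrier M) h \<in> om_iso N M"
proof -
  interpret M: ordered_monoid M by fact
  define g where "g = inv_into (carrier M) h"
  have bij: "bij_betw h (carrier M) (carrier N)"
    using h by (auto simp: om_iso_def iso_def)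
  have gbij: "bij_betw g (carrier N) (carrier M)"
    unfolding g_def using bij by (rule bij_betw_inv_into)
  have gh: "g (h x) = x" if "x \<in> carrier M" for x
    unfolding g_def using bij that by (simp add: bij_betw_inv_into_left)
  have *: "g (a \<^bold>\<and>\<^bsub>N\<^esub> b) = g a \<^bold>\<and>\<^bsub>M\<^esub> g b \<and> g (a \<^bold>\<or>\<^bsub>N\<^esub> b) = g a \<^bold>\<or>\<^bsub>M\<^esub> g b \<and>
      g (a \<otimes>\<^bsub>N\<^esub> b) = g a \<otimes>\<^bsub>M\<^esub> g b"
    if ab: "a \<in> carrier N" "b \<in> carrier N" for a b
  proof -
    obtain x y where xy: "x \<in> carrier M" "y \<in> carrier M" "a = h x" "b = h y"
      using ab bij by (metis bij_betw_imp_surj_on imageE)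
    have "h (x \<^bold>\<and>\<^bsub>M\<^esub> y) = a \<^bold>\<and>\<^bsub>N\<^esub> b" "h (x \<^bold>\<or>\<^bsub>M\<^esub> y) = a \<^bold>\<or>\<^bsub>N\<^esub> b" "h (x \<otimes>\<^bsub>M\<^esub> y) = a \<otimes>\<^bsub>N\<^esub> b"
      using h xy by (auto simp: om_iso_def iso_def hom_def)
    then show ?thesis
      using xy gh ordered_monoid_closed[OF M] by metis
  qed
  moreover have "g \<one>\<^bsub>N\<^esub> = \<one>\<^bsub>M\<^esub>"
    using h gh[OF M.one_closed] by (simp add: om_iso_def)
  moreover have "g a \<in> carrier M" if "a \<in> carrier N" for a
    using gbij that by (auto simp: bij_betw_def)
  ultimately show ?thesis
    using gbij by (auto simp: om_iso_def iso_def hom_def g_def)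
qed

lemma om_isomorphic_sym: "ordered_monoid M \<Longrightarrow> om_isomorphic M N \<Longrightarrow> om_isomorphic N M"
  by (auto simp: om_isomorphic_def dest: om_iso_inv_into)

lemma equiv_si_idempotent_oms:
  "equiv (si_idempotent_oms n)
     {(M, N). M \<in> si_idempotent_oms n \<and> N \<in> si_idempotent_oms n \<and> om_isomorphic M N}"
proof (rule equivI)
  show "sym {(M, N). M \<in> si_idempotent_oms n \<and> N \<in> si_idempotent_oms n \<and> om_isomorphic M N}"
    by (auto simp: sym_def si_idempotent_oms_def idempotent_ordered_monoid_def
        intro: om_isomorphic_sym)
qed (auto simp: refl_on_def trans_def om_isomorphic_refl intro: om_isomorphic_trans)

lemma linear_order_on_vimage:
  assumes r: "linear_order_on A r" and inj: "inj_on g B" and gB: "g ` B = A"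
  shows "linear_order_on B {(x, y). x \<in> B \<and> y \<in> B \<and> (g x, g y) \<in> r}"
proof -
  have mem: "g x \<in> A" if "x \<in> B" for x
    using that gB by auto
  have "refl_on A r" and tr: "trans r" and as: "antisym r" and tot: "total_on A r"
    using r by (auto simp: order_on_defs)
  then have "(g x, g x) \<in> r" if "x \<in> B" for x
    using mem that by (auto simp: refl_on_def)
  moreover have "x = y" if "x \<in> B" "y \<in> B" "(g x, g y) \<in> r" "(g y, g x) \<in> r" for x y
    using that as inj by (meson antisymD inj_onD)
  moreover have "(g x, g y) \<in> r \<or> (g y, g x) \<in> r" if "x \<in> B" "y \<in> B" "x \<noteq> y" for x y
    using that tot mem inj unfolding total_on_def by (metis inj_onD)
  moreover have "(g x, g z) \<in> r" if "(g x, g y) \<in> r" "(g y, g z) \<in> r" for x y z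
    using that tr by (meson transD)
  ultimately show ?thesis
    unfolding order_on_defs refl_on_def trans_def antisym_def total_on_def by blast
qed

lemma om_congruence_vimage:
  assumes N: "ordered_monoid N" and g: "g \<in> om_iso N M" and \<theta>: "om_congruence M \<theta>"
  shows "om_congruence N {(x, y). x \<in> carrier N \<and> y \<in> carrier N \<and> (g x, g y) \<in> \<theta>}"
proof -
  have eq: "equiv (carrier M) \<theta>"
    using \<theta> by (simp add: om_congruence_def)
  have mem: "g x \<in> carrier M" if "x \<in> carrier N" for x
    using g that by (auto simp: om_iso_def iso_def hom_def)
  have hom: "g (x \<otimes>\<^bsub>N\<^esub> y) = g x \<otimes>\<^bsub>M\<^esub> g y" "g (x \<^bold>\<and>\<^bsub>N\<^esub> y) = g x \<^bold>\<and>\<^bsub>M\<^esub> g y"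
    "g (x \<^bold>\<or>\<^bsub>N\<^esub> y) = g x \<^bold>\<or>\<^bsub>M\<^esub> g y" if "x \<in> carrier N" "y \<in> carrier N" for x y
    using g that by (auto simp: om_iso_def iso_def hom_def)
  have "equiv (carrier N) {(x, y). x \<in> carrier N \<and> y \<in> carrier N \<and> (g x, g y) \<in> \<theta>}"
  proof (rule equivI)
    show "refl_on (carrier N) {(x, y). x \<in> carrier N \<and> y \<in> carrier N \<and> (g x, g y) \<in> \<theta>}"
      using eq mem by (auto simp: equiv_def refl_on_def)
    show "sym {(x, y). x \<in> carrier N \<and> y \<in> carrier N \<and> (g x, g y) \<in> \<theta>}"
      using eq by (auto simp: equiv_def sym_def)
    show "trans {(x, y). x \<in> carrier N \<and> y \<in> carrier N \<and> (g x, g y) \<in> \<theta>}"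
      using eq unfolding equiv_def trans_def by blast
  qed auto
  then show ?thesis
    using \<theta> ordered_monoid_closed[OF N] by (auto simp: om_congruence_def hom)
qed

lemma subdirectly_irreducible_om_isomorphic:
  assumes M: "ordered_monoid M" and N: "ordered_monoid N" and iso: "om_isomorphic M N"
    and si: "subdirectly_irreducible M"
  shows "subdirectly_irreducible N"
proof -
  obtain h where h: "h \<in> om_iso M N"
    using iso by (auto simp: om_isomorphic_def)
  define g where "g = inv_into (carrier M) h"
  have bij: "bij_betw h (carrier M) (carrier N)"
    using h by (auto simp: om_iso_def iso_def)
  have g: "g \<in> om_iso N M"
    unfolding g_def using M h by (rule om_iso_inv_into)
  have gh: "g (h x) = x" if "x \<in> carrier M" for x
    unfolding g_def using bij that by (simp add: bij_betw_inv_into_left)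
  have hg: "h (g y) = y" if "y \<in> carrier N" for y
    unfolding g_def using bij that by (simp add: bij_betw_inv_into_right)
  have hm: "h x \<in> carrier N" if "x \<in> carrier M" for x
    using h that by (auto simp: om_iso_def iso_def hom_def)
  have gm: "g x \<in> carrier M" if "x \<in> carrier N" for x
    using g that by (auto simp: om_iso_def iso_def hom_def)
  have "card (carrier N) = card (carrier M)"
    using h by (auto simp: om_iso_def iso_def dest: bij_betw_same_card)
  show ?thesis
  proof (cases "card (carrier M) = 1")
    case True
    then show ?thesis
      using \<open>card (carrier N) = card (carrier M)\<close> by (simp add: subdirectly_irreducible_def)
  next
    case False
    then obtain \<mu> where \<mu>: "om_congruence M \<mu>" "\<mu> \<noteq> Id_on (carrier M)"
      and least: "\<And>\<theta>. om_congruence M \<theta> \<Longrightarrow> \<theta> \<noteq> Id_on (carrier M) \<Longrightarrow> \<mu> \<subseteq> \<theta>"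
      using si by (auto simp: subdirectly_irreducible_def)
    have sub: "\<theta> \<subseteq> carrier M \<times> carrier M" and Id: "Id_on (carrier M) \<subseteq> \<theta>"
      if "om_congruence M \<theta>" for \<theta>
      using that by (auto simp: om_congruence_def equiv_def refl_on_def)
    have sub': "\<theta> \<subseteq> carrier N \<times> carrier N" and Id': "Id_on (carrier N) \<subseteq> \<theta>"
      if "om_congruence N \<theta>" for \<theta>
      using that by (auto simp: om_congruence_def equiv_def refl_on_def)
    let ?\<nu> = "{(x, y). x \<in> carrier N \<and> y \<in> carrier N \<and> (g x, g y) \<in> \<mu>}"
    have "om_congruence N ?\<nu>"
      using om_congruence_vimage[OF N g \<mu>(1)] .
    moreover have "?\<nu> \<noteq> Id_on (carrier N)"
    proof -
      obtain x y where xy: "(x, y) \<in> \<mu>" "x \<noteq> y" "x \<in> carrier M" "y \<in> carrier M"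
        using \<mu> sub[OF \<mu>(1)] Id[OF \<mu>(1)] by auto
      then have "(h x, h y) \<in> ?\<nu>" and "h x \<noteq> h y"
        using gh hm by (auto, metis)
      moreover have "(h x, h y) \<notin> Id_on (carrier N)"
        using \<open>h x \<noteq> h y\<close> by (simp add: Id_on_iff)
      ultimately show ?thesis
        by metis
    qed
    moreover have "?\<nu> \<subseteq> \<theta>" if \<theta>: "om_congruence N \<theta>" "\<theta> \<noteq> Id_on (carrier N)" for \<theta>
    proof -
      let ?\<theta>' = "{(x, y). x \<in> carrier M \<and> y \<in> carrier M \<and> (h x, h y) \<in> \<theta>}"
      obtain x y where xy: "(x, y) \<in> \<theta>" "x \<noteq> y" "x \<in> carrier N" "y \<in> carrier N"
        using \<theta> sub'[OF \<theta>(1)] Id'[OF \<theta>(1)] by auto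
      then have "(g x, g y) \<in> ?\<theta>'" and "g x \<noteq> g y"
        using hg gm by (auto, metis)
      moreover have "(g x, g y) \<notin> Id_on (carrier M)"
        using \<open>g x \<noteq> g y\<close> by (simp add: Id_on_iff)
      ultimately have "?\<theta>' \<noteq> Id_on (carrier M)"
        by metis
      then have "\<mu> \<subseteq> ?\<theta>'"
        using least om_congruence_vimage[OF M h \<theta>(1)] by blast
      then show ?thesis
        using hg by auto
    qed
    ultimately show ?thesis
      unfolding subdirectly_irreducible_def by blast
  qed
qed

lemma ex_om_isomorphic_nat:
  assumes M: "idempotent_ordered_monoid M" and si: "subdirectly_irreducible M"
    and fin: "finite (carrier M)"
  shows "\<exists>N\<in>si_idempotent_oms (card (carrier M)). om_isomorphic M N"
proof -
  interpret M: idempotent_ordered_monoid M by fact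
  obtain h where h: "bij_betw h (carrier M) {..<card (carrier M)}"
    using fin ex_bij_betw_finite_nat[OF fin] by (auto simp: atLeast0LessThan)
  define B where "B = {..<card (carrier M)}"
  define g where "g = inv_into (carrier M) h"
  have hB: "bij_betw h (carrier M) B"
    using h by (simp add: B_def)
  have gB: "bij_betw g B (carrier M)"
    unfolding g_def using hB by (rule bij_betw_inv_into)
  have gh [simp]: "g (h x) = x" if "x \<in> carrier M" for x
    unfolding g_def using hB that by (simp add: bij_betw_inv_into_left)
  have hg [simp]: "h (g y) = y" if "y \<in> B" for y
    unfolding g_def using hB that by (simp add: bij_betw_inv_into_right)
  have hm [simp]: "h x \<in> B" if "x \<in> carrier M" for x
    using hB that by (auto simp: bij_betw_def)
  have gm [simp]: "g y \<in> carrier M" if "y \<in> B" for y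
    using gB that by (auto simp: bij_betw_def)
  define N :: "nat ordered_monoid" where
    "N = \<lparr>carrier = B, mult = (\<lambda>x y. h (g x \<otimes>\<^bsub>M\<^esub> g y)), one = h \<one>\<^bsub>M\<^esub>,
       wedge = (\<lambda>x y. h (g x \<^bold>\<and>\<^bsub>M\<^esub> g y)), vee = (\<lambda>x y. h (g x \<^bold>\<or>\<^bsub>M\<^esub> g y))\<rparr>"
  have om: "ordered_monoid M"
    by (rule M.ordered_monoid_axioms)
  note closed = ordered_monoid_closed[OF om]
  obtain r where r: "linear_order_on (carrier M) r"
    and mm: "\<And>a b. a \<in> carrier M \<Longrightarrow> b \<in> carrier M \<Longrightarrow>
      a \<^bold>\<and>\<^bsub>M\<^esub> b = (if (a, b) \<in> r then a else b) \<and> a \<^bold>\<or>\<^bsub>M\<^esub> b = (if (a, b) \<in> r then b else a)"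
    and mono: "\<And>a b c d. a \<in> carrier M \<Longrightarrow> b \<in> carrier M \<Longrightarrow> c \<in> carrier M \<Longrightarrow> d \<in> carrier M \<Longrightarrow>
      (a, b) \<in> r \<Longrightarrow> (c \<otimes>\<^bsub>M\<^esub> a \<otimes>\<^bsub>M\<^esub> d, c \<otimes>\<^bsub>M\<^esub> b \<otimes>\<^bsub>M\<^esub> d) \<in> r"
    using M.ex_order by blast
  let ?r = "{(x, y). x \<in> B \<and> y \<in> B \<and> (g x, g y) \<in> r}"
  have lin: "linear_order_on B ?r"
    using linear_order_on_vimage[OF r] gB by (auto simp: bij_betw_def)
  have N: "idempotent_ordered_monoid N"
  proof unfold_locales
    show "\<exists>r. linear_order_on (carrier N) r \<and>
      (\<forall>a\<in>carrier N. \<forall>b\<in>carrier N.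
         a \<^bold>\<and>\<^bsub>N\<^esub> b = (if (a, b) \<in> r then a else b) \<and>
         a \<^bold>\<or>\<^bsub>N\<^esub> b = (if (a, b) \<in> r then b else a)) \<and>
      (\<forall>a\<in>carrier N. \<forall>b\<in>carrier N. \<forall>c\<in>carrier N. \<forall>d\<in>carrier N.
         (a, b) \<in> r \<longrightarrow> (c \<otimes>\<^bsub>N\<^esub> a \<otimes>\<^bsub>N\<^esub> d, c \<otimes>\<^bsub>N\<^esub> b \<otimes>\<^bsub>N\<^esub> d) \<in> r)"
      by (rule exI[of _ ?r]) (use lin mm mono in \<open>auto simp: N_def\<close>)
  qed (auto simp: N_def M.m_assoc M.idem)
  have "h \<in> om_iso M N"
    using hB closed by (auto simp: om_iso_def iso_def hom_def N_def)
  then have iso: "om_isomorphic M N"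
    by (auto simp: om_isomorphic_def)
  have "subdirectly_irreducible N"
    using subdirectly_irreducible_om_isomorphic[OF om _ iso si] N
    by (simp add: idempotent_ordered_monoid_def)
  then have "N \<in> si_idempotent_oms (card (carrier M))"
    using N by (simp add: si_idempotent_oms_def N_def B_def)
  then show ?thesis
    using iso by blast
qed

end

theory Submission
  imports Defs
begin

text \<open>
  In an idempotent ordered monoid every product \<open>a b\<close> is \<open>a\<close> or \<open>b\<close> (\<open>mult_conservative\<close>). Hence
  the quotient by Green's relation \<open>D\<close> is a chain, with the class of the identity at one end. Two
  elements on the same side of the identity commute, so a \<open>D\<close>-class other than that of the
  identity consists of one element below it, of one element above it, or of one of each; in the
  last case the class is a left-zero or a right-zero band. On either side of the identity, an element
  is the further away the deeper its class lies. A finite algebra is thus described by the word that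
  lists the types of its classes from the identity downwards: four letters, two of weight \<open>1\<close> and two
  of weight \<open>2\<close>. Conversely each word describes an algebra, here realised on integers, whose absolute
  values are the levels of the classes. Every finite algebra is obtained (\<open>ex_word\<close>, by removing the
  deepest class), and different words give non-isomorphic algebras (\<open>word_om_isomorphic_imp_eq\<close>,
  since isomorphisms preserve levels and signs).

  Identifying all elements of level at most \<open>1\<close> is a congruence. It lies below every congruence that
  identifies some element with the identity. So the algebra of a nonempty word fails to be subdirectly
  irreducible exactly if, under some non-trivial
  congruence, the identity is congruent to no other element. Such a congruence
  can only identify elements of the same sign, and if the levels of \<open>x < y\<close> enclose (weakly) an
  element \<open>p\<close> of the opposite sign, then multiplying by \<open>p\<close> makes \<open>p\<close> congruent to one of them
  and hence to the identity. What remains are two consecutive classes that are singletons of the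
  same sign, and collapsing these is indeed a congruence. The subdirectly irreducible algebras
  therefore correspond to the words in which no letter of weight \<open>1\<close> is repeated consecutively.

  Let \<open>T m\<close> be the number of these words of weight \<open>m\<close>, and \<open>A m\<close> the number of those that begin
  with a given letter of weight \<open>1\<close>. Deleting the first letter yields \<open>A (m + 1) = T m - A m\<close> and
  \<open>T (m + 2) = 2 A (m + 2) + 2 T m\<close>; eliminating \<open>A\<close> gives
  \<open>T (m + 3) = T (m + 2) + 2 T (m + 1) + 2 T m\<close>. An algebra has one element more than the weight of
  its word.
\<close>

section \<open>The algebra of a word\<close>

text \<open>The types of \<open>D\<close>-classes other than that of the identity: a single element below it, a single element
above it, or one of each that form a left-zero or a right-zero band.\<close>

datatype letter = Neg | Pos | Lzero | Rzero

fun weight :: "letter \<Rightarrow> nat" where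
  "weight Neg = 1"
| "weight Pos = 1"
| "weight Lzero = 2"
| "weight Rzero = 2"

text \<open>Levels are counted from \<open>1\<close>, positions in a list from \<open>0\<close>; level \<open>0\<close> belongs to the identity and has
no letter.\<close>

definition letter_at :: "letter list \<Rightarrow> int \<Rightarrow> letter" where
  "letter_at w x = w ! (nat \<bar>x\<bar> - 1)"

fun signs :: "letter \<Rightarrow> int set" where
  "signs Neg = {-1}"
| "signs Pos = {1}"
| "signs Lzero = {-1, 1}"
| "signs Rzero = {-1, 1}"

text \<open>The elements of level \<open>i\<close> are \<open>-i\<close> or \<open>i\<close> or both, so that the order of the integers is the order of
the algebra and \<open>0\<close> is the identity.\<close>

definition word_carrier :: "letter list \<Rightarrow> int set" where
  "word_carrier w = insert 0 {x. x \<noteq> 0 \<and> \<bar>x\<bar> \<le> int (length w) \<and> sgn x \<in> signs (letter_at w x)}"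

definition word_mult :: "letter list \<Rightarrow> int \<Rightarrow> int \<Rightarrow> int" where
  "word_mult w x y = (if \<bar>x\<bar> < \<bar>y\<bar> then y else if \<bar>y\<bar> < \<bar>x\<bar> then x
     else if letter_at w x = Rzero then y else x)"

definition word_om :: "letter list \<Rightarrow> int ordered_monoid" where
  "word_om w = \<lparr>carrier = word_carrier w, mult = word_mult w, one = 0, wedge = min, vee = max\<rparr>"

lemma word_om_simps [simp]:
  "carrier (word_om w) = word_carrier w" "mult (word_om w) = word_mult w" "one (word_om w) = 0"
  "wedge (word_om w) = min" "vee (word_om w) = max"
  by (simp_all add: word_om_def)

lemma letter_at_cong: "\<bar>x\<bar> = \<bar>y\<bar> \<Longrightarrow> letter_at w x = letter_at w y"
  by (simp add: letter_at_def)

lemma zero_in_word_carrier [simp]: "0 \<in> word_carrier w"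
  by (simp add: word_carrier_def)

lemma word_carrier_abs_le: "x \<in> word_carrier w \<Longrightarrow> \<bar>x\<bar> \<le> int (length w)"
  by (auto simp: word_carrier_def)

lemma word_mult_cases: "word_mult w x y = x \<or> word_mult w x y = y"
  by (simp add: word_mult_def)

lemma word_mult_zero [simp]: "word_mult w 0 x = x" "word_mult w x 0 = x"
  by (auto simp: word_mult_def)

lemma word_mult_idem [simp]: "word_mult w x x = x"
  by (simp add: word_mult_def)

lemma word_mult_deeper:
  "\<bar>x\<bar> < \<bar>y\<bar> \<Longrightarrow> word_mult w x y = y" "\<bar>x\<bar> < \<bar>y\<bar> \<Longrightarrow> word_mult w y x = y"
  by (auto simp: word_mult_def)

lemma word_mult_deeper_converse:
  assumes "word_mult w x y = x" "word_mult w y x = x" "x \<noteq> y"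
  shows "\<bar>y\<bar> < \<bar>x\<bar>"
  using assms letter_at_cong[of x y w] unfolding word_mult_def by (metis linorder_neqE)

lemma word_mult_assoc: "word_mult w (word_mult w x y) z = word_mult w x (word_mult w y z)"
proof -
  consider "\<bar>x\<bar> < \<bar>y\<bar>" | "\<bar>y\<bar> < \<bar>x\<bar>" | "\<bar>x\<bar> = \<bar>y\<bar>" "letter_at w x = letter_at w y"
    by (metis letter_at_cong linorder_neqE)
  then show ?thesis
    unfolding word_mult_def by cases (smt (verit))+
qed

lemma word_mult_mono:
  assumes "x \<le> y"
  shows "word_mult w z x \<le> word_mult w z y" "word_mult w x z \<le> word_mult w y z"
  using assms letter_at_cong[of x z w] letter_at_cong[of y z w]
  unfolding word_mult_def by (smt (verit))+

text \<open>Associativity and monotonicity of the product hold on all integers, and every set that contains \<open>0\<close>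
is closed under a product that returns one of its arguments.\<close>

lemma idempotent_ordered_monoid_word_om: "idempotent_ordered_monoid (word_om w)"
proof unfold_locales
  let ?C = "word_carrier w"
  show "\<exists>r. linear_order_on (carrier (word_om w)) r \<and>
      (\<forall>a\<in>carrier (word_om w). \<forall>b\<in>carrier (word_om w).
         a \<^bold>\<and>\<^bsub>word_om w\<^esub> b = (if (a, b) \<in> r then a else b) \<and>
         a \<^bold>\<or>\<^bsub>word_om w\<^esub> b = (if (a, b) \<in> r then b else a)) \<and>
      (\<forall>a\<in>carrier (word_om w). \<forall>b\<in>carrier (word_om w).
       \<forall>c\<in>carrier (word_om w). \<forall>d\<in>carrier (word_om w).
         (a, b) \<in> r \<longrightarrow> (c \<otimes>\<^bsub>word_om w\<^esub> a \<otimes>\<^bsub>word_om w\<^esub> d, c \<otimes>\<^bsub>word_om w\<^esub> b \<otimes>\<^bsub>word_om w\<^esub> d) \<in> r)"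
  proof (rule exI[of _ "{(x, y). x \<in> ?C \<and> y \<in> ?C \<and> x \<le> y}"], intro conjI ballI impI)
    show "linear_order_on (carrier (word_om w)) {(x, y). x \<in> ?C \<and> y \<in> ?C \<and> x \<le> y}"
      by (auto simp: order_on_defs refl_on_def trans_def antisym_def total_on_def)
  next
    fix a b c d
    assume "a \<in> carrier (word_om w)" "b \<in> carrier (word_om w)" "c \<in> carrier (word_om w)"
      "d \<in> carrier (word_om w)" "(a, b) \<in> {(x, y). x \<in> ?C \<and> y \<in> ?C \<and> x \<le> y}"
    moreover have "word_mult w x y \<in> ?C" if "x \<in> ?C" "y \<in> ?C" for x y
      using that word_mult_cases[of w x y] by auto
    ultimately show "(c \<otimes>\<^bsub>word_om w\<^esub> a \<otimes>\<^bsub>word_om w\<^esub> d, c \<otimes>\<^bsub>word_om w\<^esub> b \<otimes>\<^bsub>word_om w\<^esub> d)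
        \<in> {(x, y). x \<in> ?C \<and> y \<in> ?C \<and> x \<le> y}"
      by (auto intro!: word_mult_mono)
  qed auto
next
  fix x y
  assume "x \<in> carrier (word_om w)" "y \<in> carrier (word_om w)"
  then show "x \<otimes>\<^bsub>word_om w\<^esub> y \<in> carrier (word_om w)"
    using word_mult_cases[of w x y] by auto
qed (auto simp: word_mult_assoc)

lemma letter_at_append: "x \<noteq> 0 \<Longrightarrow> \<bar>x\<bar> \<le> int (length w) \<Longrightarrow> letter_at (w @ v) x = letter_at w x"
  by (auto simp: letter_at_def nth_append)

lemma letter_at_snoc: "\<bar>x\<bar> = int (length w) + 1 \<Longrightarrow> letter_at (w @ [l]) x = l"
  by (simp add: letter_at_def nth_append nat_add_distrib)

lemma word_mult_append:
  assumes "\<bar>x\<bar> \<le> int (length w)" "\<bar>y\<bar> \<le> int (length w)"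
  shows "word_mult (w @ v) x y = word_mult w x y"
  using assms letter_at_append[of x w v] by (cases "x = 0") (auto simp: word_mult_def)

lemma word_carrier_snoc:
  "word_carrier (w @ [l]) = word_carrier w \<union> (\<lambda>s. s * (int (length w) + 1)) ` signs l"
    (is "?A = ?B")
proof (rule Set.set_eqI)
  fix x
  consider "\<bar>x\<bar> \<le> int (length w)" | "\<bar>x\<bar> = int (length w) + 1" | "\<bar>x\<bar> > int (length w) + 1"
    by linarith
  then show "x \<in> ?A \<longleftrightarrow> x \<in> ?B"
  proof cases
    case 1
    then have "x \<notin> (\<lambda>s. s * (int (length w) + 1)) ` signs l"
      by (cases l) auto
    with 1 show ?thesis
      by (auto simp: word_carrier_def letter_at_append)
  next
    case 2
    then have "x \<notin> word_carrier w"
      by (auto dest: word_carrier_abs_le)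
    moreover have "x = sgn x * (int (length w) + 1)" "x \<noteq> 0"
      using 2 by (metis mult_sgn_abs, auto)
    moreover have "sgn x \<in> signs l" if "x \<in> (\<lambda>s. s * (int (length w) + 1)) ` signs l"
      using that by (cases l) (auto simp: sgn_if)
    ultimately show ?thesis
      using 2 letter_at_snoc[OF 2] by (auto simp: word_carrier_def)
  next
    case 3
    then have "x \<notin> (\<lambda>s. s * (int (length w) + 1)) ` signs l"
      by (cases l) auto
    with 3 show ?thesis
      by (auto dest: word_carrier_abs_le)
  qed
qed

lemma card_word_carrier:
  "finite (word_carrier w) \<and> card (word_carrier w) = 1 + sum_list (map weight w)"
proof (induction w rule: rev_induct)
  case Nil
  have "word_carrier [] = {0}"
    by (auto simp: word_carrier_def)
  then show ?case
    by simp
next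
  case (snoc l w)
  let ?K = "(\<lambda>s. s * (int (length w) + 1)) ` signs l"
  have "word_carrier w \<inter> ?K = {}"
    by (cases l) (auto dest!: word_carrier_abs_le)
  moreover have "finite ?K" "card ?K = weight l"
    by (cases l; simp)+
  ultimately show ?case
    using snoc by (simp add: word_carrier_snoc card_Un_disjoint)
qed

lemma level_inhabited:
  assumes "i \<le> length w"
  shows "\<exists>x \<in> word_carrier w. \<bar>x\<bar> = int i"
proof (cases "i = 0")
  case False
  then have "- int i \<in> word_carrier w \<or> int i \<in> word_carrier w"
    using assms letter_at_cong[of "- int i" "int i" w]
    by (cases "letter_at w (int i)") (auto simp: word_carrier_def)
  then show ?thesis
    by force
qed (auto intro: bexI[of _ 0])

section \<open>The word is determined by the algebra\<close>

text \<open>That \<open>x\<close> lies strictly deeper than \<open>y\<close> is expressible by products, so an isomorphism sends a chain of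
elements at the levels \<open>0, ..., \<bar>x\<bar>\<close> to one of strictly increasing level that ends at \<open>h x\<close>.\<close>

lemma om_iso_word_om_abs_le:
  assumes h: "h \<in> om_iso (word_om w) (word_om v)" and x: "x \<in> word_carrier w"
  shows "\<bar>x\<bar> \<le> \<bar>h x\<bar>"
  using x
proof (induction "nat \<bar>x\<bar>" arbitrary: x)
  case 0
  then show ?case
    by simp
next
  case (Suc i)
  have "i \<le> length w"
    using Suc.hyps(2) word_carrier_abs_le[OF Suc.prems] by linarith
  then obtain y where y: "y \<in> word_carrier w" "\<bar>y\<bar> = int i"
    using level_inhabited by blast
  then have "\<bar>y\<bar> \<le> \<bar>h y\<bar>"
    using Suc.hyps(1)[of y] by simp
  have "\<bar>y\<bar> < \<bar>x\<bar>"
    using Suc.hyps(2) y by linarith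
  then have "word_mult w x y = x" "word_mult w y x = x" "x \<noteq> y"
    by (auto simp: word_mult_deeper)
  moreover have "h (word_mult w a b) = word_mult v (h a) (h b)"
    if "a \<in> word_carrier w" "b \<in> word_carrier w" for a b
    using h that by (auto simp: om_iso_def iso_def hom_def)
  moreover have "inj_on h (word_carrier w)"
    using h by (auto simp: om_iso_def iso_def bij_betw_def)
  ultimately have "word_mult v (h x) (h y) = h x" "word_mult v (h y) (h x) = h x" "h x \<noteq> h y"
    using Suc.prems y by (metis, metis, metis inj_onD)
  then have "\<bar>h y\<bar> < \<bar>h x\<bar>"
    by (rule word_mult_deeper_converse)
  then show ?case
    using \<open>\<bar>y\<bar> \<le> \<bar>h y\<bar>\<close> y Suc.hyps(2) by linarith
qed

text \<open>An isomorphism and its inverse do not lower levels, and they preserve the order relative to \<open>0\<close>, so the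
isomorphism is the identity. Hence the carriers and the products agree, and these determine each
letter.\<close>

lemma word_om_isomorphic_imp_eq:
  assumes "om_isomorphic (word_om w) (word_om v)"
  shows "w = v"
proof -
  obtain h where h: "h \<in> om_iso (word_om w) (word_om v)"
    using assms by (auto simp: om_isomorphic_def)
  let ?g = "inv_into (word_carrier w) h"
  have om: "ordered_monoid (word_om w)"
    using idempotent_ordered_monoid_word_om[of w] by (simp add: idempotent_ordered_monoid_def)
  have g: "?g \<in> om_iso (word_om v) (word_om w)"
    using om_iso_inv_into[OF om h] by simp
  have bij: "bij_betw h (word_carrier w) (word_carrier v)"
    using h by (auto simp: om_iso_def iso_def)
  have fixed: "h x = x" if x: "x \<in> word_carrier w" for x
  proof -
    have "h x \<in> word_carrier v"
      using bij x by (auto simp: bij_betw_def)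
    then have "\<bar>h x\<bar> \<le> \<bar>x\<bar>"
      using om_iso_word_om_abs_le[OF g] bij x by (metis bij_betw_inv_into_left)
    then have abs: "\<bar>h x\<bar> = \<bar>x\<bar>"
      using om_iso_word_om_abs_le[OF h x] by simp
    have "h (min x 0) = min (h x) (h 0)" "h 0 = 0"
      using h x by (auto simp: om_iso_def)
    then have "x \<le> 0 \<longleftrightarrow> h x \<le> 0 \<and> x \<le> 0" "0 \<le> x \<longrightarrow> 0 \<le> h x"
      by (metis min.absorb1 min.cobounded2, metis min.absorb2 min.cobounded1)
    then show ?thesis
      using abs by linarith
  qed
  then have C: "word_carrier w = word_carrier v"
    using bij by (auto simp: bij_betw_def)
  have mult: "word_mult w x y = word_mult v x y" if "x \<in> word_carrier w" "y \<in> word_carrier w" for x y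
  proof -
    have "h (word_mult w x y) = word_mult v (h x) (h y)"
      using h that by (auto simp: om_iso_def iso_def hom_def)
    then show ?thesis
      using fixed that word_mult_cases[of w x y] by metis
  qed
  have le: "length u \<le> length u'" if "word_carrier u = word_carrier u'" for u u'
  proof -
    obtain x where "x \<in> word_carrier u" "\<bar>x\<bar> = int (length u)"
      using level_inhabited[of "length u" u] by auto
    then show ?thesis
      using that word_carrier_abs_le[of x u'] by auto
  qed
  have len: "length w = length v"
    using le C by (simp add: antisym)
  show ?thesis
  proof (rule nth_equalityI)
    fix i
    assume i: "i < length w"
    let ?x = "int i + 1"
    have l: "letter_at w ?x = w ! i" "letter_at v ?x = v ! i"
      "letter_at w (- ?x) = w ! i" "letter_at v (- ?x) = v ! i"
      by (auto simp: letter_at_def nat_add_distrib)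
    have mem: "?x \<in> word_carrier w \<longleftrightarrow> 1 \<in> signs (w ! i)" "- ?x \<in> word_carrier w \<longleftrightarrow> -1 \<in> signs (w ! i)"
      "?x \<in> word_carrier v \<longleftrightarrow> 1 \<in> signs (v ! i)" "- ?x \<in> word_carrier v \<longleftrightarrow> -1 \<in> signs (v ! i)"
      using i len l by (auto simp: word_carrier_def sgn_if)
    have "word_mult w ?x (- ?x) = word_mult v ?x (- ?x)"
      if "1 \<in> signs (w ! i)" "-1 \<in> signs (w ! i)"
      using mult mem that by blast
    then show "w ! i = v ! i"
      using mem C l by (cases "w ! i"; cases "v ! i") (auto simp: word_mult_def)
  qed (rule len)
qed

section \<open>Every finite algebra comes from a word\<close>

abbreviation om_le :: "('a, 'm) ordered_monoid_scheme \<Rightarrow> 'a \<Rightarrow> 'a \<Rightarrow> bool" where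
  "om_le M a b \<equiv> a \<^bold>\<and>\<^bsub>M\<^esub> b = a"

context ordered_monoid
begin

lemma
  shows om_le_refl: "a \<in> carrier M \<Longrightarrow> om_le M a a"
    and om_le_antisym: "\<lbrakk>a \<in> carrier M; b \<in> carrier M; om_le M a b; om_le M b a\<rbrakk> \<Longrightarrow> a = b"
    and om_le_trans: "\<lbrakk>a \<in> carrier M; b \<in> carrier M; c \<in> carrier M; om_le M a b; om_le M b c\<rbrakk>
      \<Longrightarrow> om_le M a c"
    and om_le_total: "\<lbrakk>a \<in> carrier M; b \<in> carrier M\<rbrakk> \<Longrightarrow> om_le M a b \<or> om_le M b a"
    and wedge_eq: "\<lbrakk>a \<in> carrier M; b \<in> carrier M\<rbrakk> \<Longrightarrow> a \<^bold>\<and> b = (if om_le M a b then a else b)"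
    and vee_eq: "\<lbrakk>a \<in> carrier M; b \<in> carrier M\<rbrakk> \<Longrightarrow> a \<^bold>\<or> b = (if om_le M a b then b else a)"
    and mult_left_mono: "\<lbrakk>a \<in> carrier M; b \<in> carrier M; c \<in> carrier M; om_le M a b\<rbrakk>
      \<Longrightarrow> om_le M (c \<otimes> a) (c \<otimes> b)"
    and mult_right_mono: "\<lbrakk>a \<in> carrier M; b \<in> carrier M; c \<in> carrier M; om_le M a b\<rbrakk>
      \<Longrightarrow> om_le M (a \<otimes> c) (b \<otimes> c)"
proof -
  obtain r where lin: "linear_order_on (carrier M) r"
    and ops: "\<And>a b. \<lbrakk>a \<in> carrier M; b \<in> carrier M\<rbrakk> \<Longrightarrow>
       a \<^bold>\<and> b = (if (a, b) \<in> r then a else b) \<and> a \<^bold>\<or> b = (if (a, b) \<in> r then b else a)"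
    and mono: "\<And>a b c d. \<lbrakk>a \<in> carrier M; b \<in> carrier M; c \<in> carrier M; d \<in> carrier M; (a, b) \<in> r\<rbrakk>
       \<Longrightarrow> (c \<otimes> a \<otimes> d, c \<otimes> b \<otimes> d) \<in> r"
    using ex_order by blast
  have refl: "(a, a) \<in> r" if "a \<in> carrier M" for a
    using lin that by (auto simp: order_on_defs refl_on_def)
  have le: "om_le M a b \<longleftrightarrow> (a, b) \<in> r" if "a \<in> carrier M" "b \<in> carrier M" for a b
    using ops[OF that] refl that by auto
  show "a \<in> carrier M \<Longrightarrow> om_le M a a" for a
    using le refl by blast
  show "\<lbrakk>a \<in> carrier M; b \<in> carrier M; om_le M a b; om_le M b a\<rbrakk> \<Longrightarrow> a = b" for a b
    using lin by (simp add: le order_on_defs antisym_def)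
  show "\<lbrakk>a \<in> carrier M; b \<in> carrier M; c \<in> carrier M; om_le M a b; om_le M b c\<rbrakk> \<Longrightarrow> om_le M a c"
    for a b c
    using lin by (simp add: le order_on_defs) (meson transD)
  show "\<lbrakk>a \<in> carrier M; b \<in> carrier M\<rbrakk> \<Longrightarrow> om_le M a b \<or> om_le M b a" for a b
    using lin refl unfolding order_on_defs total_on_def by (metis le)
  show "\<lbrakk>a \<in> carrier M; b \<in> carrier M\<rbrakk> \<Longrightarrow> a \<^bold>\<and> b = (if om_le M a b then a else b)"
    "\<lbrakk>a \<in> carrier M; b \<in> carrier M\<rbrakk> \<Longrightarrow> a \<^bold>\<or> b = (if om_le M a b then b else a)" for a b
    using ops le by presburger+
  show "\<lbrakk>a \<in> carrier M; b \<in> carrier M; c \<in> carrier M; om_le M a b\<rbrakk> \<Longrightarrow> om_le M (c \<otimes> a) (c \<otimes> b)"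
    "\<lbrakk>a \<in> carrier M; b \<in> carrier M; c \<in> carrier M; om_le M a b\<rbrakk> \<Longrightarrow> om_le M (a \<otimes> c) (b \<otimes> c)"
    for a b c
    using mono[of a b c \<one>] mono[of a b \<one> c] by (auto simp: le)
qed

lemma ex_least_greatest:
  assumes "finite A" "A \<noteq> {}" "A \<subseteq> carrier M"
  shows "\<exists>b\<in>A. \<exists>t\<in>A. \<forall>x\<in>A. om_le M b x \<and> om_le M x t"
  using assms
proof (induction rule: finite_ne_induct)
  case (singleton x)
  then show ?case
    by (auto simp: om_le_refl)
next
  case (insert a A)
  then obtain b t where bt: "b \<in> A" "t \<in> A" "\<And>x. x \<in> A \<Longrightarrow> om_le M b x \<and> om_le M x t"
    by auto
  define b' where "b' = (if om_le M a b then a else b)"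
  define t' where "t' = (if om_le M t a then a else t)"
  have cl: "a \<in> carrier M" "b \<in> carrier M" "t \<in> carrier M" "\<And>x. x \<in> A \<Longrightarrow> x \<in> carrier M"
    using bt insert.prems by auto
  have "om_le M b' a" "om_le M b' b" "om_le M a t'" "om_le M t t'"
    using om_le_total[of a b] om_le_total[of a t] om_le_refl cl by (auto simp: b'_def t'_def)
  moreover have "b' \<in> carrier M" "t' \<in> carrier M"
    using cl by (auto simp: b'_def t'_def)
  ultimately have "om_le M b' x \<and> om_le M x t'" if "x \<in> insert a A" for x
    using that bt om_le_trans cl by (metis insert_iff)
  moreover have "b' \<in> insert a A" "t' \<in> insert a A"
    using bt by (auto simp: b'_def t'_def)
  ultimately show ?case
    by blast
qed

lemma om_iso_word_omI:
  assumes bij: "bij_betw h (carrier M) (word_carrier w)" and one: "h \<one> = 0"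
    and mult: "\<And>x y. \<lbrakk>x \<in> carrier M; y \<in> carrier M\<rbrakk> \<Longrightarrow> h (x \<otimes> y) = word_mult w (h x) (h y)"
    and mono: "\<And>x y. \<lbrakk>x \<in> carrier M; y \<in> carrier M; om_le M x y\<rbrakk> \<Longrightarrow> h x \<le> h y"
  shows "h \<in> om_iso M (word_om w)"
proof -
  have "h (x \<^bold>\<and> y) = min (h x) (h y) \<and> h (x \<^bold>\<or> y) = max (h x) (h y)"
    if "x \<in> carrier M" "y \<in> carrier M" for x y
  proof (cases "om_le M x y")
    case True
    then show ?thesis
      using mono[of x y] vee_eq[of x y] that by simp
  next
    case False
    then have "x \<^bold>\<and> y = y" "x \<^bold>\<or> y = x" "om_le M y x"
      using that wedge_eq[of x y] vee_eq[of x y] om_le_total[of x y] by metis+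
    then show ?thesis
      using mono[of y x] that by simp
  qed
  then show ?thesis
    using assms bij_betwE[OF bij] by (auto simp: om_iso_def iso_def hom_def)
qed

end

context idempotent_ordered_monoid
begin

text \<open>Monotonicity puts \<open>a b\<close> between \<open>a\<close> and \<open>b\<close>. Comparing \<open>a b\<close> with the identity and multiplying by the
factor on the appropriate side bounds it from the other direction, because \<open>a (a b) = a b = (a b) b\<close>.\<close>

lemma mult_conservative:
  assumes a: "a \<in> carrier M" and b: "b \<in> carrier M"
  shows "a \<otimes> b = a \<or> a \<otimes> b = b"
proof -
  have le: "om_le M x (x \<otimes> y)" "om_le M (x \<otimes> y) y" "om_le M x (y \<otimes> x)" "om_le M (y \<otimes> x) y"
    if "x \<in> carrier M" "y \<in> carrier M" "om_le M x y" for x y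
    using mult_left_mono[of x y x] mult_right_mono[of x y x] mult_left_mono[of x y y]
      mult_right_mono[of x y y] that
    by (simp_all add: idem)
  have aab: "a \<otimes> (a \<otimes> b) = a \<otimes> b" and abb: "(a \<otimes> b) \<otimes> b = a \<otimes> b"
    using a b by (metis idem m_assoc, metis idem m_assoc)
  have ab: "a \<otimes> b \<in> carrier M"
    using a b by simp
  show ?thesis
  proof (cases "om_le M a b")
    case True
    note * = le(1,2)[OF a b True]
    show ?thesis
    proof (cases "om_le M (a \<otimes> b) \<one>")
      case True
      then have "om_le M (a \<otimes> b) a"
        using mult_left_mono[OF ab one_closed a] a aab by simp
      then show ?thesis
        using * om_le_antisym a ab by blast
    next
      case False
      then have "om_le M \<one> (a \<otimes> b)"
        using om_le_total ab by blast
      then have "om_le M b (a \<otimes> b)"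
        using mult_right_mono[OF one_closed ab b] b abb by simp
      then show ?thesis
        using * om_le_antisym b ab by blast
    qed
  next
    case False
    then have "om_le M b a"
      using om_le_total a b by blast
    note * = le(3,4)[OF b a this]
    show ?thesis
    proof (cases "om_le M (a \<otimes> b) \<one>")
      case True
      then have "om_le M (a \<otimes> b) b"
        using mult_right_mono[OF ab one_closed b] b abb by simp
      then show ?thesis
        using * om_le_antisym b ab by blast
    next
      case False
      then have "om_le M \<one> (a \<otimes> b)"
        using om_le_total ab by blast
      then have "om_le M a (a \<otimes> b)"
        using mult_left_mono[OF one_closed ab a] a aab by simp
      then show ?thesis
        using * om_le_antisym a ab by blast
    qed
  qed
qed

text \<open>As products return one of their factors, every subset containing the identity is a subalgebra.\<close>

lemma idempotent_ordered_monoid_restrict: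
  assumes A: "A \<subseteq> carrier M" and one: "\<one> \<in> A"
  shows "idempotent_ordered_monoid (M\<lparr>carrier := A\<rparr>)"
proof -
  have cl: "x \<otimes> y \<in> A" if "x \<in> A" "y \<in> A" for x y
    using mult_conservative[of x y] that A by (metis subsetD)
  have mem: "x \<in> carrier M" if "x \<in> A" for x
    using that A by auto
  show ?thesis
  proof unfold_locales
    let ?N = "M\<lparr>carrier := A\<rparr>" and ?r = "{(x, y). x \<in> A \<and> y \<in> A \<and> om_le M x y}"
    have "linear_order_on A ?r"
      unfolding order_on_defs
    proof (intro conjI)
      show "trans ?r"
        using om_le_trans mem by (intro transI) blast
      show "total_on A ?r"
        using om_le_total mem by (auto simp: total_on_def)
    qed (use om_le_refl om_le_antisym mem in \<open>auto simp: refl_on_def antisym_def\<close>)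
    then show "\<exists>r. linear_order_on (carrier ?N) r \<and>
      (\<forall>a\<in>carrier ?N. \<forall>b\<in>carrier ?N. a \<^bold>\<and>\<^bsub>?N\<^esub> b = (if (a, b) \<in> r then a else b) \<and>
         a \<^bold>\<or>\<^bsub>?N\<^esub> b = (if (a, b) \<in> r then b else a)) \<and>
      (\<forall>a\<in>carrier ?N. \<forall>b\<in>carrier ?N. \<forall>c\<in>carrier ?N. \<forall>d\<in>carrier ?N.
         (a, b) \<in> r \<longrightarrow> (c \<otimes>\<^bsub>?N\<^esub> a \<otimes>\<^bsub>?N\<^esub> d, c \<otimes>\<^bsub>?N\<^esub> b \<otimes>\<^bsub>?N\<^esub> d) \<in> r)"
    proof (intro exI[of _ ?r] conjI ballI impI)
      fix a b
      assume "a \<in> carrier ?N" "b \<in> carrier ?N"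
      then show "a \<^bold>\<and>\<^bsub>?N\<^esub> b = (if (a, b) \<in> ?r then a else b)"
        "a \<^bold>\<or>\<^bsub>?N\<^esub> b = (if (a, b) \<in> ?r then b else a)"
        using wedge_eq[of a b] vee_eq[of a b] mem by simp_all
    next
      fix a b c d
      assume "a \<in> carrier ?N" "b \<in> carrier ?N" "c \<in> carrier ?N" "d \<in> carrier ?N" "(a, b) \<in> ?r"
      then show "(c \<otimes>\<^bsub>?N\<^esub> a \<otimes>\<^bsub>?N\<^esub> d, c \<otimes>\<^bsub>?N\<^esub> b \<otimes>\<^bsub>?N\<^esub> d) \<in> ?r"
        using cl mem by (simp add: mult_right_mono mult_left_mono)
    qed simp
  qed (use one cl mem m_assoc idem in auto)
qed

text \<open>A class \<open>K\<close> that absorbs all other elements and consists of extremal elements can be placed at the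
next level: the isomorphism \<open>h\<close> on the rest extends to \<open>K\<close> with the prescribed signs.\<close>

lemma om_isomorphic_word_om_snoc:
  assumes K: "K \<subseteq> carrier M" and one: "\<one> \<notin> K"
    and h: "h \<in> om_iso (M\<lparr>carrier := carrier M - K\<rparr>) (word_om w)"
    and absorb: "\<And>x y. \<lbrakk>x \<in> K; y \<in> carrier M - K\<rbrakk> \<Longrightarrow> x \<otimes> y = x \<and> y \<otimes> x = x"
    and KK: "\<And>x y. \<lbrakk>x \<in> K; y \<in> K\<rbrakk> \<Longrightarrow> x \<otimes> y = (if l = Rzero then y else x)"
    and s: "bij_betw s K (signs l)"
    and least: "\<And>x y. \<lbrakk>x \<in> K; y \<in> carrier M; s x = -1\<rbrakk> \<Longrightarrow> om_le M x y"
    and greatest: "\<And>x y. \<lbrakk>x \<in> K; y \<in> carrier M; s x = 1\<rbrakk> \<Longrightarrow> om_le M y x"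
  shows "om_isomorphic M (word_om (w @ [l]))"
proof -
  let ?n = "int (length w) + 1"
  define g where "g x = (if x \<in> K then s x * ?n else h x)" for x
  have hb: "bij_betw h (carrier M - K) (word_carrier w)"
    using h by (auto simp: om_iso_def iso_def)
  have hmem: "h x \<in> word_carrier w" if "x \<in> carrier M - K" for x
    using hb that by (auto simp: bij_betw_def)
  have hle: "\<bar>h x\<bar> \<le> int (length w)" if "x \<in> carrier M - K" for x
    using hmem[OF that] by (rule word_carrier_abs_le)
  have sK: "s x = -1 \<or> s x = 1" if "x \<in> K" for x
    using bij_betwE[OF s] that by (cases l) auto
  have gK: "\<bar>g x\<bar> = ?n" if "x \<in> K" for x
    using sK[OF that] that by (auto simp: g_def)
  have gM: "\<bar>g x\<bar> < ?n" "g x = h x" if "x \<in> carrier M - K" for x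
    using hle[OF that] that by (auto simp: g_def)
  have "bij_betw g (carrier M) (word_carrier (w @ [l]))"
  proof -
    have "bij_betw g (carrier M - K) (word_carrier w)"
      using hb by (rule bij_betw_cong[THEN iffD1, rotated]) (simp add: g_def)
    moreover have "bij_betw g K ((\<lambda>i. i * ?n) ` signs l)"
    proof -
      have "bij_betw (\<lambda>i. i * ?n) (signs l) ((\<lambda>i. i * ?n) ` signs l)"
        by (auto simp: bij_betw_def inj_on_def)
      then have "bij_betw ((\<lambda>i. i * ?n) \<circ> s) K ((\<lambda>i. i * ?n) ` signs l)"
        using s bij_betw_trans by blast
      then show ?thesis
        by (rule bij_betw_cong[THEN iffD1, rotated]) (simp add: g_def)
    qed
    moreover have "word_carrier w \<inter> (\<lambda>i. i * ?n) ` signs l = {}"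
      by (cases l) (auto dest!: word_carrier_abs_le)
    ultimately have "bij_betw g ((carrier M - K) \<union> K) (word_carrier w \<union> (\<lambda>i. i * ?n) ` signs l)"
      by (rule bij_betw_combine)
    then show ?thesis
      using K by (simp add: word_carrier_snoc Un_absorb2)
  qed
  moreover have "g \<one> = 0"
    using h one by (simp add: om_iso_def g_def)
  moreover have "g (x \<otimes> y) = word_mult (w @ [l]) (g x) (g y)"
    if xy: "x \<in> carrier M" "y \<in> carrier M" for x y
  proof (cases "x \<in> K")
    case True
    show ?thesis
    proof (cases "y \<in> K")
      case True
      then show ?thesis
        using KK[OF \<open>x \<in> K\<close> True] gK \<open>x \<in> K\<close> by (simp add: word_mult_def letter_at_snoc)
    next
      case False
      then show ?thesis
        using absorb[of x y] True xy gK[of x] gM[of y] by (simp add: word_mult_deeper)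
    qed
  next
    case False
    show ?thesis
    proof (cases "y \<in> K")
      case True
      then show ?thesis
        using absorb[of y x] False xy gK[of y] gM[of x] by (simp add: word_mult_deeper)
    next
      case y: False
      then have "x \<otimes> y \<in> carrier M - K"
        using mult_conservative[OF xy] False xy by auto
      moreover have "h (x \<otimes> y) = word_mult w (h x) (h y)"
        using h y False xy by (auto simp: om_iso_def iso_def hom_def)
      ultimately show ?thesis
        using y False xy gM hle by (simp add: word_mult_append)
    qed
  qed
  moreover have "g x \<le> g y" if xy: "x \<in> carrier M" "y \<in> carrier M" "om_le M x y" for x y
  proof -
    have bound: "\<bar>g x\<bar> \<le> ?n" "\<bar>g y\<bar> \<le> ?n"
      using gK gM xy by (metis DiffI order.refl order.strict_implies_order)+
    consider "x \<in> K" "s x = -1" | "y \<in> K" "s y = 1" | "x \<in> K" "s x = 1" | "y \<in> K" "s y = -1"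
      | "x \<in> carrier M - K" "y \<in> carrier M - K"
      using sK xy by blast
    then show ?thesis
    proof cases
      case 1
      then have "g x = - ?n"
        by (simp add: g_def)
      then show ?thesis
        using bound by linarith
    next
      case 2
      then have "g y = ?n"
        by (simp add: g_def)
      then show ?thesis
        using bound by linarith
    next
      case 3
      then show ?thesis
        using greatest[of x y] om_le_antisym xy by auto
    next
      case 4
      then show ?thesis
        using least[of y x] om_le_antisym xy by auto
    next
      case 5
      then have "h x = min (h x) (h y)"
        using h xy by (auto simp: om_iso_def) (metis DiffI)
      then show ?thesis
        using 5 gM by simp
    qed
  qed
  ultimately have "g \<in> om_iso M (word_om (w @ [l]))"
    by (rule om_iso_word_omI)
  then show ?thesis
    by (auto simp: om_isomorphic_def)
qed

text \<open>The deepest class is made of the least element \<open>b\<close>, of the greatest element \<open>t\<close>, or of both. Which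
case holds can be read off from \<open>b t\<close> and \<open>t b\<close>, since by monotonicity every product \<open>b x\<close> lies between \<open>b\<close>
and \<open>b t\<close>, and similarly for the other sides. The map \<open>s\<close> records the sign of an element.\<close>

lemma ex_deepest_class:
  assumes fin: "finite (carrier M)" and nontriv: "carrier M \<noteq> {\<one>}"
  shows "\<exists>K l s. K \<subseteq> carrier M \<and> \<one> \<notin> K \<and> K \<noteq> {} \<and>
    (\<forall>x\<in>K. \<forall>y\<in>carrier M - K. x \<otimes> y = x \<and> y \<otimes> x = x) \<and>
    (\<forall>x\<in>K. \<forall>y\<in>K. x \<otimes> y = (if l = Rzero then y else x)) \<and>
    bij_betw s K (signs l) \<and>
    (\<forall>x\<in>K. \<forall>y\<in>carrier M. (s x = -1 \<longrightarrow> om_le M x y) \<and> (s x = 1 \<longrightarrow> om_le M y x))"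
    (is "\<exists>K l s. ?P K l s")
proof -
  obtain b t where b: "b \<in> carrier M" and t: "t \<in> carrier M"
    and bt: "\<And>x. x \<in> carrier M \<Longrightarrow> om_le M b x" "\<And>x. x \<in> carrier M \<Longrightarrow> om_le M x t"
    using ex_least_greatest[OF fin] by blast
  have deepest: "\<exists>K l s. ?P K l s"
    if "K \<subseteq> carrier M" "\<one> \<notin> K" "K \<noteq> {}"
      and "\<And>x y. \<lbrakk>x \<in> K; y \<in> carrier M - K\<rbrakk> \<Longrightarrow> x \<otimes> y = x \<and> y \<otimes> x = x"
      and "\<And>x y. \<lbrakk>x \<in> K; y \<in> K\<rbrakk> \<Longrightarrow> x \<otimes> y = (if l = Rzero then y else x)"
      and "bij_betw s K (signs l)" "\<And>x. \<lbrakk>x \<in> K; s x = -1\<rbrakk> \<Longrightarrow> x = b"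
      "\<And>x. \<lbrakk>x \<in> K; s x = 1\<rbrakk> \<Longrightarrow> x = t"
    for K l and s :: "'a \<Rightarrow> int"
  proof (intro exI[of _ K] exI[of _ l] exI[of _ s] conjI ballI impI)
    fix x y
    assume xy: "x \<in> K" "y \<in> carrier M"
    show "om_le M x y" if "s x = -1"
      using bt(1) xy that \<open>\<And>x. \<lbrakk>x \<in> K; s x = -1\<rbrakk> \<Longrightarrow> x = b\<close> by metis
    show "om_le M y x" if "s x = 1"
      using bt(2) xy that \<open>\<And>x. \<lbrakk>x \<in> K; s x = 1\<rbrakk> \<Longrightarrow> x = t\<close> by metis
  qed (use that in metis)+
  have neq: "b \<noteq> t"
  proof
    assume "b = t"
    then have "x = b" if "x \<in> carrier M" for x
      using that bt om_le_antisym b by blast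
    then have "carrier M = {\<one>}"
      using one_closed by (metis is_singletonI' is_singleton_def singletonD empty_iff)
    then show False
      using nontriv by contradiction
  qed
  have mono: "om_le M (b \<otimes> x) (b \<otimes> t)" "om_le M (x \<otimes> b) (t \<otimes> b)" "om_le M b (b \<otimes> x)" "om_le M b (x \<otimes> b)"
    "om_le M (t \<otimes> b) (t \<otimes> x)" "om_le M (b \<otimes> t) (x \<otimes> t)" "om_le M (t \<otimes> x) t" "om_le M (x \<otimes> t) t"
    if "x \<in> carrier M" for x
    using mult_left_mono mult_right_mono bt b t that by simp_all
  have b_left: "b \<otimes> x = b" if "b \<otimes> t = b" "x \<in> carrier M" for x
    using mono[of x] that om_le_antisym b by (metis m_closed)
  have b_right: "x \<otimes> b = b" if "t \<otimes> b = b" "x \<in> carrier M" for x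
    using mono[of x] that om_le_antisym b by (metis m_closed)
  have t_left: "t \<otimes> x = t" if "t \<otimes> b = t" "x \<in> carrier M" for x
    using mono[of x] that om_le_antisym t by (metis m_closed)
  have t_right: "x \<otimes> t = t" if "b \<otimes> t = t" "x \<in> carrier M" for x
    using mono[of x] that om_le_antisym t by (metis m_closed)
  consider "b \<otimes> t = b" "t \<otimes> b = b" | "b \<otimes> t = t" "t \<otimes> b = t"
    | "b \<otimes> t = b" "t \<otimes> b = t" | "b \<otimes> t = t" "t \<otimes> b = b"
    using mult_conservative[OF b t] mult_conservative[OF t b] by blast
  then show ?thesis
  proof cases
    case 1
    then have "\<one> \<noteq> b"
      using neq t by auto
    then show ?thesis
      using 1 b b_left b_right by (intro deepest[of "{b}" Neg "\<lambda>_. -1"]) (auto simp: bij_betw_def)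
  next
    case 2
    then have "\<one> \<noteq> t"
      using neq b by auto
    then show ?thesis
      using 2 t t_left t_right by (intro deepest[of "{t}" Pos "\<lambda>_. 1"]) (auto simp: bij_betw_def)
  next
    case 3
    then have one: "\<one> \<noteq> b" "\<one> \<noteq> t"
      using neq b t by auto
    \<comment> \<open>By associativity \<open>x\<close> absorbs both of \<open>b\<close>, \<open>t\<close> or neither, and it cannot absorb the one on its
      own side of the identity.\<close>
    have "x \<otimes> b = b \<and> x \<otimes> t = t" if x: "x \<in> carrier M" "x \<noteq> b" "x \<noteq> t" for x
    proof -
      have "x \<otimes> t = x" if "x \<otimes> b = x"
        using 3(1) that x b t by (metis m_assoc)
      moreover have "x \<otimes> b = x" if "x \<otimes> t = x"
        using 3(2) that x b t by (metis m_assoc)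
      moreover have "\<not> (x \<otimes> b = x \<and> x \<otimes> t = x)"
        using om_le_total[of x \<one>] mult_right_mono[of x \<one> b] mult_right_mono[of \<one> x t]
          om_le_antisym bt x b t by (metis l_one one_closed)
      ultimately show ?thesis
        using mult_conservative[of x b] mult_conservative[of x t] x b t by blast
    qed
    then show ?thesis
      using 3 one neq b t b_left t_left
      by (intro deepest[of "{b, t}" Lzero "\<lambda>x. if x = b then -1 else 1"])
        (auto simp: bij_betw_def split: if_splits)
  next
    case 4
    then have one: "\<one> \<noteq> b" "\<one> \<noteq> t"
      using neq b t by auto
    have "b \<otimes> x = b \<and> t \<otimes> x = t" if x: "x \<in> carrier M" "x \<noteq> b" "x \<noteq> t" for x
    proof -
      have "t \<otimes> x = x" if "b \<otimes> x = x"
        using 4(2) that x b t by (metis m_assoc)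
      moreover have "b \<otimes> x = x" if "t \<otimes> x = x"
        using 4(1) that x b t by (metis m_assoc)
      moreover have "\<not> (b \<otimes> x = x \<and> t \<otimes> x = x)"
        using om_le_total[of x \<one>] mult_left_mono[of x \<one> b] mult_left_mono[of \<one> x t]
          om_le_antisym bt x b t by (metis r_one one_closed)
      ultimately show ?thesis
        using mult_conservative[of b x] mult_conservative[of t x] x b t by blast
    qed
    then show ?thesis
      using 4 one neq b t b_right t_right
      by (intro deepest[of "{b, t}" Rzero "\<lambda>x. if x = b then -1 else 1"])
        (auto simp: bij_betw_def split: if_splits)
  qed
qed

end

text \<open>Removing the deepest class leaves a smaller algebra, whose word is extended by the type of that
class.\<close>

lemma ex_word:
  assumes "idempotent_ordered_monoid M" "finite (carrier M)"
  shows "\<exists>w. om_isomorphic M (word_om w)"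
  using assms
proof (induction "card (carrier M)" arbitrary: M rule: less_induct)
  case less
  interpret idempotent_ordered_monoid M by fact
  show ?case
  proof (cases "carrier M = {\<one>\<^bsub>M\<^esub>}")
    case True
    moreover have "word_carrier [] = {0}"
      by (auto simp: word_carrier_def)
    ultimately have "(\<lambda>_. 0) \<in> om_iso M (word_om [])"
      by (intro om_iso_word_omI) (auto simp: bij_betw_def)
    then show ?thesis
      by (auto simp: om_isomorphic_def)
  next
    case False
    then obtain K l s where K: "K \<subseteq> carrier M" "\<one>\<^bsub>M\<^esub> \<notin> K" "K \<noteq> {}"
      and cls: "\<forall>x\<in>K. \<forall>y\<in>carrier M - K. x \<otimes>\<^bsub>M\<^esub> y = x \<and> y \<otimes>\<^bsub>M\<^esub> x = x"
        "\<forall>x\<in>K. \<forall>y\<in>K. x \<otimes>\<^bsub>M\<^esub> y = (if l = Rzero then y else x)"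
        "bij_betw s K (signs l)"
        "\<forall>x\<in>K. \<forall>y\<in>carrier M. (s x = -1 \<longrightarrow> om_le M x y) \<and> (s x = 1 \<longrightarrow> om_le M y x)"
      using ex_deepest_class less.prems by blast
    let ?N = "M\<lparr>carrier := carrier M - K\<rparr>"
    have "card (carrier ?N) < card (carrier M)"
      using K less.prems(2) by (auto intro!: psubset_card_mono)
    moreover have "idempotent_ordered_monoid ?N"
      using K by (intro idempotent_ordered_monoid_restrict) auto
    ultimately obtain w h where "h \<in> om_iso ?N (word_om w)"
      using less.hyps[of ?N] less.prems(2) by (auto simp: om_isomorphic_def)
    then have "om_isomorphic M (word_om (w @ [l]))"
      using cls by (intro om_isomorphic_word_om_snoc[OF K(1,2)]) auto
    then show ?thesis
      by blast
  qed
qed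

section \<open>Subdirect irreducibility\<close>

definition reduced :: "letter list \<Rightarrow> bool" where
  "reduced = successively (\<lambda>k l. k \<noteq> l \<or> weight k = 2)"

lemma word_carrier_level_iff:
  assumes "k < length w" "s = -1 \<or> s = 1"
  shows "s * (int k + 1) \<in> word_carrier w \<longleftrightarrow> s \<in> signs (w ! k)"
  using assms by (auto simp: word_carrier_def letter_at_def sgn_if nat_add_distrib)

lemma word_carrier_nonzeroE:
  assumes "x \<in> word_carrier w" "x \<noteq> 0"
  obtains s k where "k < length w" "s = -1 \<or> s = 1" "x = s * (int k + 1)" "s \<in> signs (w ! k)"
proof
  have le: "\<bar>x\<bar> \<le> int (length w)"
    using assms word_carrier_abs_le by blast
  show k: "nat \<bar>x\<bar> - 1 < length w"
    using le assms(2) by linarith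
  show s: "sgn x = -1 \<or> sgn x = 1"
    using assms(2) by (auto simp: sgn_if)
  have "int (nat \<bar>x\<bar> - 1) + 1 = \<bar>x\<bar>"
    using assms(2) by linarith
  then show x: "x = sgn x * (int (nat \<bar>x\<bar> - 1) + 1)"
    by (simp add: sgn_mult_abs)
  then show "sgn x \<in> signs (w ! (nat \<bar>x\<bar> - 1))"
    using word_carrier_level_iff[OF k s] assms(1) by simp
qed

lemma om_congruence_word_om_iff:
  "om_congruence (word_om w) \<theta> \<longleftrightarrow> equiv (word_carrier w) \<theta> \<and>
    (\<forall>f\<in>{min, max, word_mult w}. \<forall>x x' y y'. (x, x') \<in> \<theta> \<longrightarrow> (y, y') \<in> \<theta> \<longrightarrow> (f x y, f x' y') \<in> \<theta>)"
  by (auto simp: om_congruence_def)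

definition collapse :: "int set \<Rightarrow> int set \<Rightarrow> (int \<times> int) set" where
  "collapse A K = Id_on A \<union> K \<times> K"

text \<open>If no element outside \<open>K\<close> lies between elements of \<open>K\<close>, in the order or (weakly) in
level, then minimum, maximum and product with an outside element \<open>z\<close> either send all of \<open>K\<close> to \<open>z\<close> or fix \<open>K\<close> pointwise.\<close>

lemma om_congruence_collapse:
  assumes K: "K \<subseteq> word_carrier w"
    and convex: "\<And>x y z. \<lbrakk>x \<in> K; y \<in> K; z \<in> word_carrier w - K; x \<le> z\<rbrakk> \<Longrightarrow> y \<le> z"
    and levels: "\<And>z. z \<in> word_carrier w - K \<Longrightarrow> (\<forall>x\<in>K. \<bar>x\<bar> < \<bar>z\<bar>) \<or> (\<forall>x\<in>K. \<bar>z\<bar> < \<bar>x\<bar>)"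
  shows "om_congruence (word_om w) (collapse (word_carrier w) K)"
proof -
  let ?C = "word_carrier w"
  have compat: "(f x y, f x' y') \<in> collapse ?C K"
    if cons: "\<And>x y. f x y = x \<or> f x y = y"
      and uniform: "\<And>x x' z. \<lbrakk>x \<in> K; x' \<in> K; z \<in> ?C - K\<rbrakk> \<Longrightarrow>
        (f x z = z \<and> f x' z = z \<or> f x z = x \<and> f x' z = x') \<and>
        (f z x = z \<and> f z x' = z \<or> f z x = x \<and> f z x' = x')"
      and mem: "(x, x') \<in> collapse ?C K" "(y, y') \<in> collapse ?C K"
    for f :: "int \<Rightarrow> int \<Rightarrow> int" and x x' y y'
  proof -
    have cases: "u \<in> K \<and> u' \<in> K \<or> u \<in> ?C - K \<and> u' = u" if "(u, u') \<in> collapse ?C K" for u u'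
      using that by (auto simp: collapse_def)
    have intros: "(u, u) \<in> collapse ?C K" if "u \<in> ?C" for u
      using that by (auto simp: collapse_def)
    have introsK: "(u, u') \<in> collapse ?C K" if "u \<in> K" "u' \<in> K" for u u'
      using that by (auto simp: collapse_def)
    show ?thesis
    proof (cases "x \<in> K")
      case True
      then have x: "x \<in> K" "x' \<in> K"
        using cases[OF mem(1)] by auto
      show ?thesis
      proof (cases "y \<in> K")
        case True
        then have "y \<in> K" "y' \<in> K"
          using cases[OF mem(2)] by auto
        then show ?thesis
          using x cons[of x y] cons[of x' y'] introsK by metis
      next
        case False
        then have y: "y \<in> ?C - K" "y' = y"
          using cases[OF mem(2)] by auto
        then show ?thesis
          using uniform[OF x y(1)] introsK x intros by (metis DiffD1)
      qed
    next
      case False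
      then have x: "x \<in> ?C - K" "x' = x"
        using cases[OF mem(1)] by auto
      show ?thesis
      proof (cases "y \<in> K")
        case True
        then have y: "y \<in> K" "y' \<in> K"
          using cases[OF mem(2)] by auto
        then show ?thesis
          using uniform[OF y x(1)] introsK x intros by (metis DiffD1)
      next
        case False
        then have y: "y \<in> ?C - K" "y' = y"
          using cases[OF mem(2)] by auto
        then show ?thesis
          using x cons[of x y] intros by (metis DiffD1)
      qed
    qed
  qed
  have "equiv ?C (collapse ?C K)"
    using K by (intro equivI) (auto simp: collapse_def refl_on_def sym_def trans_def)
  moreover have "(min x y, min x' y') \<in> collapse ?C K" "(max x y, max x' y') \<in> collapse ?C K"
    if "(x, x') \<in> collapse ?C K" "(y, y') \<in> collapse ?C K" for x x' y y'
  proof -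
    have side: "x \<le> z \<and> y \<le> z \<or> z \<le> x \<and> z \<le> y" if "x \<in> K" "y \<in> K" "z \<in> ?C - K" for x y z
      using convex[OF that] convex[OF that(2,1,3)] by linarith
    show "(min x y, min x' y') \<in> collapse ?C K"
    proof (rule compat[OF _ _ that])
      show "(min x z = z \<and> min y z = z \<or> min x z = x \<and> min y z = y) \<and>
          (min z x = z \<and> min z y = z \<or> min z x = x \<and> min z y = y)"
        if "x \<in> K" "y \<in> K" "z \<in> ?C - K" for x y z
        using side[OF that] by (metis min.absorb1 min.absorb2)
    qed linarith
    show "(max x y, max x' y') \<in> collapse ?C K"
    proof (rule compat[OF _ _ that])
      show "(max x z = z \<and> max y z = z \<or> max x z = x \<and> max y z = y) \<and>
          (max z x = z \<and> max z y = z \<or> max z x = x \<and> max z y = y)"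
        if "x \<in> K" "y \<in> K" "z \<in> ?C - K" for x y z
        using side[OF that] by (metis max.absorb1 max.absorb2)
    qed linarith
  qed
  moreover have "(word_mult w x y, word_mult w x' y') \<in> collapse ?C K"
    if "(x, x') \<in> collapse ?C K" "(y, y') \<in> collapse ?C K" for x x' y y'
  proof (rule compat[OF word_mult_cases _ that])
    fix x x' z
    assume "x \<in> K" "x' \<in> K" "z \<in> ?C - K"
    then have "\<bar>x\<bar> < \<bar>z\<bar> \<and> \<bar>x'\<bar> < \<bar>z\<bar> \<or> \<bar>z\<bar> < \<bar>x\<bar> \<and> \<bar>z\<bar> < \<bar>x'\<bar>"
      using levels by blast
    then show "(word_mult w x z = z \<and> word_mult w x' z = z \<or> word_mult w x z = x \<and> word_mult w x' z = x') \<and>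
        (word_mult w z x = z \<and> word_mult w z x' = z \<or> word_mult w z x = x \<and> word_mult w z x' = x')"
      by (metis word_mult_deeper)
  qed
  ultimately show ?thesis
    by (simp add: om_congruence_word_om_iff)
qed

text \<open>For a nonempty reduced word this is the least non-trivial congruence.\<close>

definition top_collapse :: "letter list \<Rightarrow> (int \<times> int) set" where
  "top_collapse w = collapse (word_carrier w) {x \<in> word_carrier w. \<bar>x\<bar> \<le> 1}"

lemma om_congruence_top_collapse: "om_congruence (word_om w) (top_collapse w)"
  unfolding top_collapse_def
proof (rule om_congruence_collapse)
  fix x y z
  assume "x \<in> {x \<in> word_carrier w. \<bar>x\<bar> \<le> 1}" "y \<in> {x \<in> word_carrier w. \<bar>x\<bar> \<le> 1}"
    "z \<in> word_carrier w - {x \<in> word_carrier w. \<bar>x\<bar> \<le> 1}" "x \<le> z"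
  then have "\<bar>x\<bar> \<le> 1" "\<bar>y\<bar> \<le> 1" "\<bar>z\<bar> > 1" "x \<le> z"
    by auto
  then show "y \<le> z"
    by linarith
qed auto

lemma top_collapse_nontrivial:
  assumes "w \<noteq> []"
  shows "top_collapse w \<noteq> Id_on (word_carrier w)"
proof -
  have "1 \<le> length w"
    using assms by (simp add: Suc_leI)
  then obtain x where "x \<in> word_carrier w" "\<bar>x\<bar> = 1"
    using level_inhabited[of 1 w] by auto
  then have "(x, 0) \<in> top_collapse w" "(x, 0) \<notin> Id_on (word_carrier w)"
    by (auto simp: top_collapse_def collapse_def)
  then show ?thesis
    by metis
qed

lemma word_mult_absorb: "\<bar>y\<bar> \<le> \<bar>x\<bar> \<Longrightarrow> word_mult w x y = x \<or> word_mult w y x = x"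
  unfolding word_mult_def using letter_at_cong[of x y w] by (metis not_le order.antisym)

text \<open>Either the class of \<open>y\<close> has two elements, or the next class, which is not deeper than \<open>x\<close>, does not
consist of a single element of the same sign.\<close>

lemma ex_opposite_between:
  assumes w: "reduced w" and x: "x \<in> word_carrier w" and y: "y \<in> word_carrier w" "y \<noteq> 0"
    and xy: "\<bar>y\<bar> < \<bar>x\<bar>"
  shows "\<exists>p\<in>word_carrier w. sgn p = - sgn y \<and> \<bar>y\<bar> \<le> \<bar>p\<bar> \<and> \<bar>p\<bar> \<le> \<bar>x\<bar>"
proof -
  obtain s k where k: "k < length w" and s: "s = -1 \<or> s = 1" and ys: "y = s * (int k + 1)"
    "s \<in> signs (w ! k)"
    using y by (elim word_carrier_nonzeroE)
  have absy: "\<bar>y\<bar> = int k + 1" and sgny: "sgn y = s"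
    using ys s by (auto simp: sgn_if)
  have Sk: "Suc k < length w"
    using xy absy word_carrier_abs_le[OF x] by linarith
  show ?thesis
  proof (cases "- s \<in> signs (w ! k)")
    case True
    then have "- s * (int k + 1) \<in> word_carrier w"
      using word_carrier_level_iff[OF k, of "- s"] s by auto
    moreover have "- s * (int k + 1) = - y"
      using ys by simp
    ultimately show ?thesis
      using xy by (intro bexI[of _ "- y"]) (auto simp: sgn_minus)
  next
    case False
    have "w ! k \<noteq> w ! Suc k \<or> weight (w ! k) = 2"
      using w Sk by (auto simp: reduced_def successively_conv_nth)
    then have "- s \<in> signs (w ! Suc k)"
      using False ys(2) s by (cases "w ! k"; cases "w ! Suc k") auto
    then have "- s * (int (Suc k) + 1) \<in> word_carrier w"
      using word_carrier_level_iff[OF Sk, of "- s"] s by auto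
    moreover have "\<bar>- s * (int (Suc k) + 1)\<bar> = \<bar>y\<bar> + 1" "sgn (- s * (int (Suc k) + 1)) = - sgn y"
      using absy sgny s by (auto simp: sgn_if)
    ultimately show ?thesis
      using xy by (intro bexI[of _ "- s * (int (Suc k) + 1)"]) auto
  qed
qed

text \<open>Two congruent elements of opposite sign are congruent to \<open>0\<close> by convexity. For elements of equal sign, an
element \<open>p\<close> of opposite sign at a level between theirs turns \<open>(x, y)\<close> into \<open>(x, p)\<close> by
multiplication.\<close>

lemma congruence_collapses_to_zero:
  assumes w: "reduced w" and \<theta>: "om_congruence (word_om w) \<theta>" "\<theta> \<noteq> Id_on (word_carrier w)"
  shows "\<exists>z. z \<noteq> 0 \<and> (z, 0) \<in> \<theta>"
proof -
  let ?C = "word_carrier w"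
  have eq: "equiv ?C \<theta>"
    and compat: "\<And>x x' y y'. \<lbrakk>(x, x') \<in> \<theta>; (y, y') \<in> \<theta>\<rbrakk> \<Longrightarrow> (min x y, min x' y') \<in> \<theta>"
      "\<And>x x' y y'. \<lbrakk>(x, x') \<in> \<theta>; (y, y') \<in> \<theta>\<rbrakk> \<Longrightarrow> (max x y, max x' y') \<in> \<theta>"
      "\<And>x x' y y'. \<lbrakk>(x, x') \<in> \<theta>; (y, y') \<in> \<theta>\<rbrakk> \<Longrightarrow> (word_mult w x y, word_mult w x' y') \<in> \<theta>"
    using \<theta>(1) by (simp_all add: om_congruence_word_om_iff)
  have refl: "(x, x) \<in> \<theta>" if "x \<in> ?C" for x
    using eq that by (auto simp: equiv_def refl_on_def)
  have sym: "(y, x) \<in> \<theta>" if "(x, y) \<in> \<theta>" for x y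
    using eq that by (auto simp: equiv_def sym_def)
  have mem: "x \<in> ?C" "y \<in> ?C" if "(x, y) \<in> \<theta>" for x y
    using eq that by (auto simp: equiv_def)
  have opposite: "(x, 0) \<in> \<theta>" if "(x, p) \<in> \<theta>" "sgn p = - sgn x" for x p
  proof -
    have "min x 0 = x \<and> min p 0 = 0 \<or> max x 0 = x \<and> max p 0 = 0"
      using that(2) by (auto simp: sgn_if min_def max_def split: if_splits)
    then show ?thesis
      using compat(1,2)[OF that(1) refl[of 0]] by auto
  qed
  obtain x y where xy: "(x, y) \<in> \<theta>" "x \<noteq> y" "\<bar>y\<bar> \<le> \<bar>x\<bar>"
  proof -
    have "\<exists>x y. (x, y) \<in> \<theta> \<and> x \<noteq> y"
      using \<theta>(2) refl mem by (auto simp: Id_on_def) blast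
    then show ?thesis
      using that sym by (metis linorder_le_cases)
  qed
  have "x \<noteq> 0"
    using xy by auto
  have "y = 0 \<or> sgn y = - sgn x \<or> sgn y = sgn x"
    using \<open>x \<noteq> 0\<close> by (auto simp: sgn_if)
  then consider "y = 0" | "sgn y = - sgn x" | "y \<noteq> 0" "sgn y = sgn x"
    by blast
  then have "(x, 0) \<in> \<theta>"
  proof cases
    case 1
    then show ?thesis
      using xy by simp
  next
    case 2
    then show ?thesis
      using opposite xy by blast
  next
    case 3
    then have "\<bar>y\<bar> < \<bar>x\<bar>"
      using xy by (metis mult_sgn_abs order_le_less)
    then obtain p where p: "p \<in> ?C" "sgn p = - sgn x" "\<bar>y\<bar> \<le> \<bar>p\<bar>" "\<bar>p\<bar> \<le> \<bar>x\<bar>"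
      using ex_opposite_between[OF w _ _ 3(1)] mem[OF xy(1)] 3(2) by metis
    \<comment> \<open>The level of \<open>p\<close> differs from that of \<open>x\<close> or of \<open>y\<close>, so one side serves for both products.\<close>
    have "word_mult w x p = x \<and> word_mult w y p = p \<or> word_mult w p x = x \<and> word_mult w p y = p"
    proof (cases "\<bar>p\<bar> < \<bar>x\<bar>")
      case True
      then show ?thesis
        using word_mult_absorb[OF p(3), of w] word_mult_deeper[OF True] by metis
    next
      case False
      then have "\<bar>y\<bar> < \<bar>p\<bar>"
        using p \<open>\<bar>y\<bar> < \<bar>x\<bar>\<close> by linarith
      then show ?thesis
        using word_mult_absorb[OF p(4), of w] word_mult_deeper by metis
    qed
    then have "(x, p) \<in> \<theta>"
      using compat(3)[OF xy(1) refl[OF p(1)]] compat(3)[OF refl[OF p(1)] xy(1)] by auto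
    then show ?thesis
      using opposite p by blast
  qed
  then show ?thesis
    using \<open>x \<noteq> 0\<close> by blast
qed

text \<open>Once some \<open>z \<noteq> 0\<close> is congruent to \<open>0\<close>, so is every \<open>y\<close> of level at most \<open>1\<close>: on a suitable side, multiplying
\<open>(z, 0)\<close> by \<open>y\<close> gives \<open>(z, y)\<close>.\<close>

lemma subdirectly_irreducible_word_om_if_reduced:
  assumes w: "reduced w"
  shows "subdirectly_irreducible (word_om w)"
proof (cases "w = []")
  case True
  then show ?thesis
    using card_word_carrier[of w] by (simp add: subdirectly_irreducible_def)
next
  case False
  let ?C = "word_carrier w"
  have "top_collapse w \<subseteq> \<theta>" if \<theta>: "om_congruence (word_om w) \<theta>" "\<theta> \<noteq> Id_on ?C" for \<theta>
  proof -
    obtain z where z: "z \<noteq> 0" "(z, 0) \<in> \<theta>"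
      using congruence_collapses_to_zero[OF w \<theta>] by blast
    have eq: "equiv ?C \<theta>"
      and compat: "\<And>x x' y y'. \<lbrakk>(x, x') \<in> \<theta>; (y, y') \<in> \<theta>\<rbrakk> \<Longrightarrow> (word_mult w x y, word_mult w x' y') \<in> \<theta>"
      using \<theta>(1) by (simp_all add: om_congruence_word_om_iff)
    have refl: "(x, x) \<in> \<theta>" if "x \<in> ?C" for x
      using eq that by (auto simp: equiv_def refl_on_def)
    have zero: "(0, y) \<in> \<theta>" if y: "y \<in> ?C" "\<bar>y\<bar> \<le> 1" for y
    proof -
      have "\<bar>y\<bar> \<le> \<bar>z\<bar>"
        using z(1) y(2) by linarith
      then have "word_mult w z y = z \<or> word_mult w y z = z"
        by (rule word_mult_absorb)
      then have "(z, y) \<in> \<theta>"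
        using compat[OF z(2) refl[OF y(1)]] compat[OF refl[OF y(1)] z(2)] by auto
      then show ?thesis
        using eq z(2) by (meson equiv_def symD transD)
    qed
    have "(x, y) \<in> \<theta>" if "x \<in> ?C" "y \<in> ?C" "\<bar>x\<bar> \<le> 1" "\<bar>y\<bar> \<le> 1" for x y
      using zero that eq by (meson equiv_def symD transD)
    then show ?thesis
      using refl by (auto simp: top_collapse_def collapse_def)
  qed
  then show ?thesis
    using om_congruence_top_collapse[of w] top_collapse_nontrivial[OF False]
    unfolding subdirectly_irreducible_def by (intro disjI2 exI[of _ "top_collapse w"]) simp
qed

text \<open>Two consecutive singleton classes \<open>{a}\<close>, \<open>{b}\<close> of the same sign can be collapsed on their own. As \<open>b\<close> has
level at least \<open>2\<close>, this congruence meets \<open>top_collapse w\<close> in the identity relation, so there is no least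
non-trivial congruence.\<close>

lemma reduced_if_subdirectly_irreducible_word_om:
  assumes si: "subdirectly_irreducible (word_om w)"
  shows "reduced w"
proof (rule ccontr)
  let ?C = "word_carrier w"
  assume "\<not> reduced w"
  then obtain k where k: "Suc k < length w" "w ! k = w ! Suc k" "weight (w ! k) \<noteq> 2"
    by (auto simp: reduced_def successively_conv_nth)
  then have kl: "k < length w"
    by simp
  obtain s where s: "signs (w ! k) = {s}" "s = -1 \<or> s = 1"
    using k(3) by (cases "w ! k") auto
  define a where "a = s * (int k + 1)"
  define b where "b = s * (int (Suc k) + 1)"
  have abs: "\<bar>a\<bar> = int k + 1" "\<bar>b\<bar> = int k + 2"
    using s(2) by (auto simp: a_def b_def)
  have ab: "a \<in> ?C" "b \<in> ?C"
    using word_carrier_level_iff[OF kl s(2)] word_carrier_level_iff[OF k(1) s(2)] s(1) k(2)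
    by (simp_all add: a_def b_def)
  have levels: "\<bar>z\<bar> < int k + 1 \<or> int k + 2 < \<bar>z\<bar>" if z: "z \<in> ?C - {a, b}" for z
  proof (rule ccontr)
    assume "\<not> ?thesis"
    then have "z \<noteq> 0" "\<bar>z\<bar> = int k + 1 \<or> \<bar>z\<bar> = int k + 2"
      by auto
    moreover obtain s' k' where "k' < length w" "s' = -1 \<or> s' = 1" "z = s' * (int k' + 1)"
      "s' \<in> signs (w ! k')"
      using z \<open>z \<noteq> 0\<close> by (blast elim: word_carrier_nonzeroE)
    moreover from this have "\<bar>z\<bar> = int k' + 1"
      by auto
    ultimately have "k' = k \<or> k' = Suc k" "s' \<in> signs (w ! k')" "z = s' * (int k' + 1)"
      by auto
    then show False
      using z s(1) k(2) by (auto simp: a_def b_def)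
  qed
  have "om_congruence (word_om w) (collapse ?C {a, b})"
  proof (rule om_congruence_collapse)
    fix z
    assume z: "z \<in> ?C - {a, b}"
    then show "(\<forall>x\<in>{a, b}. \<bar>x\<bar> < \<bar>z\<bar>) \<or> (\<forall>x\<in>{a, b}. \<bar>z\<bar> < \<bar>x\<bar>)"
      using levels[OF z] abs by auto
  next
    fix x y z
    assume "x \<in> {a, b}" "y \<in> {a, b}" and z: "z \<in> ?C - {a, b}" and "x \<le> z"
    moreover have "sgn a = sgn b"
      using s(2) by (auto simp: a_def b_def sgn_if)
    then have "a < z \<longleftrightarrow> b < z"
      using levels[OF z] abs by (auto simp: sgn_if split: if_splits)
    ultimately show "y \<le> z"
      by auto
  qed (use ab in auto)
  moreover have "a \<noteq> b"
    using abs by auto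
  then have "(a, b) \<in> collapse ?C {a, b}" "(a, b) \<notin> Id_on ?C"
    by (auto simp: collapse_def)
  then have "collapse ?C {a, b} \<noteq> Id_on ?C"
    by metis
  moreover have "w \<noteq> []"
    using k by auto
  then have "card ?C \<noteq> 1"
    using card_word_carrier[of w] by (cases w; cases "hd w") auto
  ultimately obtain \<mu> where \<mu>: "om_congruence (word_om w) \<mu>" "\<mu> \<noteq> Id_on ?C" "\<mu> \<subseteq> collapse ?C {a, b}"
    "\<mu> \<subseteq> top_collapse w"
    using si om_congruence_top_collapse[of w] top_collapse_nontrivial[OF \<open>w \<noteq> []\<close>]
    by (auto simp: subdirectly_irreducible_def)
  have "collapse ?C {a, b} \<inter> top_collapse w \<subseteq> Id_on ?C"
    using abs by (auto simp: collapse_def top_collapse_def)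
  moreover have "Id_on ?C \<subseteq> \<mu>"
    using \<mu>(1) by (auto simp: om_congruence_word_om_iff equiv_def refl_on_def)
  ultimately show False
    using \<mu> by blast
qed

section \<open>Counting reduced words\<close>

definition reduced_words :: "nat \<Rightarrow> letter list set" where
  "reduced_words m = {w. reduced w \<and> sum_list (map weight w) = m}"

definition reduced_words_from :: "letter \<Rightarrow> nat \<Rightarrow> letter list set" where
  "reduced_words_from l m = {w \<in> reduced_words m. w \<noteq> [] \<and> hd w = l}"

lemma weight_pos: "0 < weight l"
  by (cases l) auto

lemma finite_reduced_words: "finite (reduced_words m)"
proof (rule finite_subset)
  have "UNIV = {Neg, Pos, Lzero, Rzero}"
    using letter.exhaust by auto
  then have "finite (UNIV :: letter set)"
    by (metis finite.emptyI finite_insert)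
  then show "finite {w :: letter list. set w \<subseteq> UNIV \<and> length w \<le> m}"
    by (rule finite_lists_length_le)
  have "length w \<le> sum_list (map weight w)" for w
  proof (induction w)
    case (Cons l w)
    then show ?case
      using weight_pos[of l] by simp
  qed simp
  then show "reduced_words m \<subseteq> {w. set w \<subseteq> UNIV \<and> length w \<le> m}"
    by (auto simp: reduced_words_def)
qed

lemma card_Cons_image: "card ((#) l ` W) = card W"
  by (simp add: card_image)

lemma reduced_Cons: "reduced (l # w) \<longleftrightarrow> reduced w \<and> (w = [] \<or> l \<noteq> hd w \<or> weight l = 2)"
  by (cases w) (auto simp: reduced_def)

lemma reduced_words_0: "reduced_words 0 = {[]}"
proof -
  have "w = []" if "sum_list (map weight w) = 0" for w
    using that weight_pos[of "hd w"] by (cases w) auto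
  then show ?thesis
    by (auto simp: reduced_words_def reduced_def)
qed

text \<open>Prefixing \<open>l\<close> keeps a word reduced unless that word already begins with \<open>l\<close>.\<close>

lemma reduced_words_from_weight_1:
  assumes "weight l = 1"
  shows "card (reduced_words_from l (Suc m)) + card (reduced_words_from l m) = card (reduced_words m)"
proof -
  have "reduced_words_from l (Suc m) = (#) l ` (reduced_words m - reduced_words_from l m)"
  proof (rule Set.set_eqI)
    show "w \<in> reduced_words_from l (Suc m) \<longleftrightarrow> w \<in> (#) l ` (reduced_words m - reduced_words_from l m)"
      for w
      using assms by (cases w) (auto simp: reduced_words_from_def reduced_words_def reduced_Cons)
  qed
  moreover have "reduced_words_from l m \<subseteq> reduced_words m"
    by (auto simp: reduced_words_from_def)
  ultimately show ?thesis
    using finite_reduced_words[of m]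
    by (simp add: card_Cons_image card_Diff_subset finite_subset card_mono)
qed

lemma reduced_words_from_weight_2:
  assumes "weight l = 2"
  shows "card (reduced_words_from l (Suc (Suc m))) = card (reduced_words m)"
proof -
  have "reduced_words_from l (Suc (Suc m)) = (#) l ` reduced_words m"
  proof (rule Set.set_eqI)
    show "w \<in> reduced_words_from l (Suc (Suc m)) \<longleftrightarrow> w \<in> (#) l ` reduced_words m" for w
      using assms by (cases w) (auto simp: reduced_words_from_def reduced_words_def reduced_Cons)
  qed
  then show ?thesis
    by (simp add: card_Cons_image)
qed

lemma card_reduced_words_Suc:
  "card (reduced_words (Suc m)) = card (reduced_words_from Neg (Suc m)) + card (reduced_words_from Pos (Suc m))
    + card (reduced_words_from Lzero (Suc m)) + card (reduced_words_from Rzero (Suc m))"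
proof -
  let ?F = "\<lambda>l. reduced_words_from l (Suc m)"
  have "w \<noteq> []" if "w \<in> reduced_words (Suc m)" for w
    using that by (auto simp: reduced_words_def)
  then have "reduced_words (Suc m) = ?F Neg \<union> ?F Pos \<union> ?F Lzero \<union> ?F Rzero"
    using letter.exhaust by (auto simp: reduced_words_from_def)
  moreover have "finite (?F l)" for l
    using finite_reduced_words by (simp add: reduced_words_from_def)
  moreover have "?F Neg \<inter> ?F Pos = {}" "(?F Neg \<union> ?F Pos) \<inter> ?F Lzero = {}"
    "(?F Neg \<union> ?F Pos \<union> ?F Lzero) \<inter> ?F Rzero = {}"
    by (auto simp: reduced_words_from_def)
  ultimately show ?thesis
    by (simp add: card_Un_disjoint)
qed

lemma reduced_words_from_0: "reduced_words_from l 0 = {}"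
  by (auto simp: reduced_words_from_def reduced_words_0)

text \<open>Both sides satisfy the recursion of \<open>reduced_words_from_weight_1\<close> with initial value \<open>0\<close>.\<close>

lemma card_reduced_words_from_Pos: "card (reduced_words_from Pos m) = card (reduced_words_from Neg m)"
proof (induction m)
  case (Suc m)
  then show ?case
    using reduced_words_from_weight_1[of Neg m] reduced_words_from_weight_1[of Pos m] by simp
qed (simp add: reduced_words_from_0)

lemma card_reduced_words_Suc_Suc:
  "card (reduced_words (Suc (Suc m))) = 2 * card (reduced_words_from Neg (Suc (Suc m))) + 2 * card (reduced_words m)"
  using card_reduced_words_Suc[of "Suc m"]
  by (simp add: card_reduced_words_from_Pos reduced_words_from_weight_2)

lemma card_reduced_words_initial:
  "card (reduced_words 0) = 1" "card (reduced_words 1) = 2" "card (reduced_words 2) = 4"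
proof -
  show T0: "card (reduced_words 0) = 1"
    by (simp add: reduced_words_0)
  have A1: "card (reduced_words_from Neg 1) = 1"
    using reduced_words_from_weight_1[of Neg 0] by (simp add: T0 reduced_words_from_0)
  have "reduced_words_from l 1 = {}" if "weight l = 2" for l
    using that by (auto simp: reduced_words_from_def reduced_words_def neq_Nil_conv)
  then show T1: "card (reduced_words 1) = 2"
    using card_reduced_words_Suc[of 0] A1 by (simp add: card_reduced_words_from_Pos)
  show "card (reduced_words 2) = 4"
    using card_reduced_words_Suc_Suc[of 0] reduced_words_from_weight_1[of Neg 1] A1 T1 T0
    by (simp add: numeral_2_eq_2)
qed

lemma card_reduced_words_rec:
  "card (reduced_words (m + 3)) =
    card (reduced_words (m + 2)) + 2 * card (reduced_words (m + 1)) + 2 * card (reduced_words m)"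
  using card_reduced_words_Suc_Suc[of "Suc m"] card_reduced_words_Suc_Suc[of m]
    reduced_words_from_weight_1[of Neg "Suc (Suc m)"]
  by (simp add: numeral_3_eq_3)


section \<open>Isomorphism classes\<close>

lemma card_quotient_kernel: "card (X // {(x, y). x \<in> X \<and> y \<in> X \<and> f x = f y}) = card (f ` X)"
proof -
  have "bij_betw (\<lambda>v. {x \<in> X. v = f x}) (f ` X) (X // {(x, y). x \<in> X \<and> y \<in> X \<and> f x = f y})"
    by (auto simp: bij_betw_def inj_on_def quotient_def)
  then show ?thesis
    by (simp add: bij_betw_same_card)
qed


lemma card_carrier_om_isomorphic: "om_isomorphic M N \<Longrightarrow> card (carrier M) = card (carrier N)"
  by (auto simp: om_isomorphic_def om_iso_def iso_def dest: bij_betw_same_card)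

text \<open>Isomorphism is the kernel of the map \<open>f\<close> that assigns to an algebra its word, so the isomorphism
classes are counted by the image of \<open>f\<close>.\<close>

lemma num_si_idempotent_oms_eq_card_reduced_words: "\<^bold>S (Suc m) = card (reduced_words m)"
proof -
  let ?X = "si_idempotent_oms (Suc m)"
  define f :: "nat ordered_monoid \<Rightarrow> letter list" where "f M = (SOME w. om_isomorphic M (word_om w))" for M
  have om: "ordered_monoid (word_om w)" for w
    using idempotent_ordered_monoid_word_om[of w] by (simp add: idempotent_ordered_monoid_def)
  have X_om: "ordered_monoid M" "idempotent_ordered_monoid M" if "M \<in> ?X" for M
    using that by (simp_all add: si_idempotent_oms_def idempotent_ordered_monoid_def)
  have f: "om_isomorphic M (word_om (f M))" if "M \<in> ?X" for M
  proof -
    have "\<exists>w. om_isomorphic M (word_om w)"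
      using ex_word[OF X_om(2)[OF that]] that by (simp add: si_idempotent_oms_def)
    then show ?thesis
      unfolding f_def by (rule someI_ex)
  qed
  have f_eq: "f M = w" if M: "M \<in> ?X" and "om_isomorphic M (word_om w)" for M w
  proof -
    have "om_isomorphic (word_om (f M)) (word_om w)"
      using om_isomorphic_trans[OF om_isomorphic_sym[OF X_om(1)[OF M] f[OF M]]] that by blast
    then show ?thesis
      by (rule word_om_isomorphic_imp_eq)
  qed
  have "om_isomorphic M N \<longleftrightarrow> f M = f N" if M: "M \<in> ?X" and N: "N \<in> ?X" for M N
  proof
    assume "om_isomorphic M N"
    then show "f M = f N"
      using f_eq[OF M] om_isomorphic_trans f[OF N] by blast
  next
    assume "f M = f N"
    then show "om_isomorphic M N"
      using om_isomorphic_trans[OF f[OF M]] om_isomorphic_sym[OF X_om(1)[OF N] f[OF N]] by simp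
  qed
  then have "\<^bold>S (Suc m) = card (f ` ?X)"
    unfolding num_si_idempotent_oms_def card_quotient_kernel[of ?X f, symmetric]
    by (intro arg_cong[where f = card] arg_cong2[where f = "(//)"]) auto
  also have "f ` ?X = reduced_words m"
  proof (intro equalityI subsetI)
    fix w
    assume "w \<in> f ` ?X"
    then obtain M where M: "M \<in> ?X" "w = f M"
      by blast
    have "card (word_carrier w) = Suc m"
      using card_carrier_om_isomorphic[OF f[OF M(1)]] M by (simp add: si_idempotent_oms_def)
    moreover have "subdirectly_irreducible (word_om w)"
      using subdirectly_irreducible_om_isomorphic[OF X_om(1) om f] M
      by (simp add: si_idempotent_oms_def)
    ultimately show "w \<in> reduced_words m"
      using card_word_carrier[of w] reduced_if_subdirectly_irreducible_word_om
      by (simp add: reduced_words_def)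
  next
    fix w
    assume w: "w \<in> reduced_words m"
    then have "card (word_carrier w) = Suc m"
      using card_word_carrier[of w] by (simp add: reduced_words_def)
    then obtain N where N: "N \<in> ?X" "om_isomorphic (word_om w) N"
      using ex_om_isomorphic_nat[OF idempotent_ordered_monoid_word_om[of w]
          subdirectly_irreducible_word_om_if_reduced] w card_word_carrier[of w]
      by (auto simp: reduced_words_def)
    then have "f N = w"
      using f_eq om_isomorphic_sym om by blast
    then show "w \<in> f ` ?X"
      using N by blast
  qed
  finally show ?thesis .
qed

theorem corollary4p4:
  shows "\<^bold>S 1 = 1 \<and> \<^bold>S 2 = 2 \<and> \<^bold>S 3 = 4 \<and>
    (\<forall>n>3. \<^bold>S n = \<^bold>S (n - 1) + 2 * \<^bold>S (n - 2) + 2 * \<^bold>S (n - 3))"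
proof (intro conjI allI impI)
  show "\<^bold>S 1 = 1" "\<^bold>S 2 = 2" "\<^bold>S 3 = 4"
    using num_si_idempotent_oms_eq_card_reduced_words[of 0]
      num_si_idempotent_oms_eq_card_reduced_words[of 1]
      num_si_idempotent_oms_eq_card_reduced_words[of 2] card_reduced_words_initial
    by (simp_all add: numeral_2_eq_2 numeral_3_eq_3)
  fix n :: nat
  assume "n > 3"
  then obtain m where "n = Suc (m + 3)"
    by (metis add.commute less_imp_Suc_add)
  then show "\<^bold>S n = \<^bold>S (n - 1) + 2 * \<^bold>S (n - 2) + 2 * \<^bold>S (n - 3)"
    using card_reduced_words_rec[of m] num_si_idempotent_oms_eq_card_reduced_words[of "m + 3"]
      num_si_idempotent_oms_eq_card_reduced_words[of "m + 2"]
      num_si_idempotent_oms_eq_card_reduced_words[of "m + 1"]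
      num_si_idempotent_oms_eq_card_reduced_words[of m]
    by (simp add: numeral_3_eq_3)
qed

end
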